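(* Let $K$ be a noetherian commutative ring with unity and $c\ge1$ an integer. Let $\mathbf{B}$ be a subalgebra of the $\mathrm{FI}$-algebra $\mathbf{P}=(\mathbf{X}^{\mathrm{FI},1})^{\otimes c}$ that is generated by monomials over $K$. Assume that for any monomials $\mu,\nu\in\mathbf{B}$, say $\nu\in\mathbf{B}_m$ and $\mu\in\mathbf{B}_n$, whenever $\mu=\varepsilon^*(\nu)\cdot\kappa$ in $\mathbf{P}_n$ for some $\varepsilon\in\mathrm{Hom}_{\mathrm{FI}}([m],[n])$ and $\kappa\in\mathbf{P}_n$, one has $\kappa\in\mathbf{B}$ (i.e. $\kappa\in\mathbf{B}_n$). Then every finitely generated $\mathrm{FI}$-module over $\mathbf{B}$ is noetherian.
   Context: $[n]=\{1,\dots,n\}$, $[0]=\emptyset$. $\mathrm{FI}$ is the category of finite sets and injective maps. An $\mathrm{FI}$-algebra over $K$ is a covariant functor $\mathbf{A}$ from $\mathrm{FI}$ to commutative associative unital $K$-algebras with $\mathbf{A}(\emptyset)=K$; $\mathbf{A}_S=\mathbf{A}(S)$, $\mathbf{A}_n=\mathbf{A}([n])$, $\varepsilon^*=\mathbf{A}(\varepsilon)$. A subalgebra is a family of $K$-subalgebras $\mathbf{B}_S\subseteq\mathbf{A}_S$ with $\varepsilon^*(\mathbf{B}_S)\subseteq\mathbf{B}_T$ for all $\varepsilon\colon S\to T$; it is generated by a subset $G\subseteq\coprod_n\mathbf{B}_n$ if $G$ is contained in no proper subalgebra of $\mathbf{B}$. The $\mathrm{FI}$-algebra $(\mathbf{X}^{\mathrm{FI},1})^{\otimes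 c}$ is given by $\mathbf{P}_S=K[x_{i,j} : i\in[c],\ j\in S]$ with $\varepsilon^*(x_{i,j})=x_{i,\varepsilon(j)}$; a monomial of $\mathbf{B}$ is a monomial in the variables $x_{i,j}$ of some $\mathbf{P}_n$ lying in $\mathbf{B}_n$. An $\mathrm{FI}$-module over $\mathbf{B}$ is a covariant functor $\mathbf{M}$ from $\mathrm{FI}$ to $K$-modules such that each $\mathbf{M}_S=\mathbf{M}(S)$ is also a $\mathbf{B}_S$-module and $\mathbf{M}(\varepsilon)(\mathbf{B}(\tilde\varepsilon)(a)\cdot q)=\mathbf{B}(\varepsilon\circ\tilde\varepsilon)(a)\cdot\mathbf{M}(\varepsilon)(q)$ for all morphisms $\tilde\varepsilon\colon\tilde S\to S$, $\varepsilon\colon S\to T$, $a\in\mathbf{B}_{\tilde S}$, $q\in\mathbf{M}_S$. Submodules are families of $\mathbf{B}_S$-submodules stable under all $\mathbf{M}(\varepsilon)$. $\mathbf{M}$ is finitely generated if some finite subset of $\coprod_{n\ge0}\mathbf{M}_n$ lies in no proper submodule; noetherian if all its submodules are finitely generated. *)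

theory Defs
  imports
    "HOL-Algebra.Module"
    "HOL-Algebra.Subrings"
    "HOL-Algebra.Ring_Divisibility"
    "HOL-Library.Poly_Mapping"
    "HOL-Library.FuncSet"
begin

text \<open>
  The category FI is taken on the finite subsets of \<open>nat\<close>. This full subcategory contains all
  \<open>{1..n}\<close> and is equivalent to the category of all finite sets. Families indexed by \<open>nat set\<close> are
  only constrained at, and only compared at, finite index sets. Maps are extensional, so that a
  morphism is determined by its values on the source.
\<close>

definition FI_hom :: "nat set \<Rightarrow> nat set \<Rightarrow> (nat \<Rightarrow> nat) set" where
  "FI_hom S T = {\<epsilon> \<in> S \<rightarrow>\<^sub>E T. inj_on \<epsilon> S}"

text \<open>A subset of a type-class ring, as a ring in the sense of HOL-Algebra.\<close>

definition ring_on :: "'a::comm_ring_1 set \<Rightarrow> 'a ring" where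
  "ring_on A = \<lparr>carrier = A, monoid.mult = (*), one = 1, zero = 0, add = (+)\<rparr>"


section \<open>The FI-algebra P and its subalgebras\<close>

text \<open>
  The pair \<open>(i, j)\<close> stands for the variable \<open>x\<^bsub>i,j\<^esub>\<close>; an exponent vector is a finitely supported
  function from variables to \<open>nat\<close>, and a polynomial is a finitely supported function from exponent
  vectors to coefficients.
\<close>

type_synonym 'k FI_poly = "((nat \<times> nat) \<Rightarrow>\<^sub>0 nat) \<Rightarrow>\<^sub>0 'k"

definition FI_const :: "'k::comm_ring_1 \<Rightarrow> 'k FI_poly" where
  "FI_const k = Poly_Mapping.single 0 k"

definition FI_var :: "nat \<Rightarrow> nat \<Rightarrow> 'k::comm_ring_1 FI_poly" where
  "FI_var i j = Poly_Mapping.single (Poly_Mapping.single (i, j) 1) 1"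

definition FI_P :: "nat \<Rightarrow> nat set \<Rightarrow> 'k::comm_ring_1 FI_poly set" where
  "FI_P c S = {p. \<forall>a \<in> Poly_Mapping.keys p. Poly_Mapping.keys a \<subseteq> {1..c} \<times> S}"

text \<open>The substitution \<open>x\<^bsub>i,j\<^esub> \<mapsto> x\<^bsub>i,\<epsilon>(j)\<^esub>\<close>, which is \<open>\<epsilon>\<^sup>*\<close> when applied to an element of \<open>FI_P c S\<close>.\<close>

definition FI_star :: "(nat \<Rightarrow> nat) \<Rightarrow> 'k::comm_ring_1 FI_poly \<Rightarrow> 'k FI_poly" where
  "FI_star \<epsilon> p =
     (\<Sum>a \<in> Poly_Mapping.keys p. FI_const (Poly_Mapping.lookup p a) *
        (\<Prod>(i, j) \<in> Poly_Mapping.keys a. FI_var i (\<epsilon> j) ^ Poly_Mapping.lookup a (i, j)))"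

definition FI_monomial :: "'k::comm_ring_1 FI_poly \<Rightarrow> bool" where
  "FI_monomial p \<longleftrightarrow> (\<exists>a. p = Poly_Mapping.single a 1)"

definition FI_subalgebra :: "nat \<Rightarrow> (nat set \<Rightarrow> 'k::comm_ring_1 FI_poly set) \<Rightarrow> bool" where
  "FI_subalgebra c B \<longleftrightarrow>
     (\<forall>S. finite S \<longrightarrow> subring (B S) (ring_on (FI_P c S)) \<and> (\<forall>k. FI_const k \<in> B S)) \<and>
     (\<forall>S T. finite S \<longrightarrow> finite T \<longrightarrow> (\<forall>\<epsilon> \<in> FI_hom S T. FI_star \<epsilon> ` B S \<subseteq> B T))"

text \<open>An element of the coproduct of the \<open>B\<^sub>n\<close> is a pair \<open>(n, f)\<close> with \<open>f \<in> B {1..n}\<close>.\<close>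

definition FI_algebra_generated_by ::
    "nat \<Rightarrow> (nat set \<Rightarrow> 'k::comm_ring_1 FI_poly set) \<Rightarrow> (nat \<times> 'k FI_poly) set \<Rightarrow> bool" where
  "FI_algebra_generated_by c B G \<longleftrightarrow>
     G \<subseteq> (SIGMA n:UNIV. B {1..n}) \<and>
     (\<forall>C. FI_subalgebra c C \<longrightarrow> (\<forall>S. finite S \<longrightarrow> C S \<subseteq> B S) \<longrightarrow>
          (\<forall>(n, f) \<in> G. f \<in> C {1..n}) \<longrightarrow> (\<forall>S. finite S \<longrightarrow> C S = B S))"


section \<open>FI-modules over B\<close>

text \<open>
  \<open>M S\<close> is a \<open>B S\<close>-module, which is a \<open>K\<close>-module through the constants \<open>FI_const k \<in> B S\<close>;
  \<open>\<phi> S T \<epsilon>\<close> is the map \<open>M(\<epsilon>)\<close> for \<open>\<epsilon> : S \<rightarrow> T\<close>.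
\<close>

locale FI_module =
  fixes B :: "nat set \<Rightarrow> 'k::comm_ring_1 FI_poly set"
    and M :: "nat set \<Rightarrow> ('k FI_poly, 'm) module"
    and \<phi> :: "nat set \<Rightarrow> nat set \<Rightarrow> (nat \<Rightarrow> nat) \<Rightarrow> 'm \<Rightarrow> 'm"
  assumes module_over_B: "finite S \<Longrightarrow> Module.module (ring_on (B S)) (M S)"
    and map_hom: "\<lbrakk>finite S; finite T; \<epsilon> \<in> FI_hom S T\<rbrakk> \<Longrightarrow>
      \<phi> S T \<epsilon> \<in> hom (add_monoid (M S)) (add_monoid (M T))"
    and map_K_linear: "\<lbrakk>finite S; finite T; \<epsilon> \<in> FI_hom S T; q \<in> carrier (M S)\<rbrakk> \<Longrightarrow>
      \<phi> S T \<epsilon> (FI_const k \<odot>\<^bsub>M S\<^esub> q) = FI_const k \<odot>\<^bsub>M T\<^esub> \<phi> S T \<epsilon> q"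
    and map_id: "\<lbrakk>finite S; q \<in> carrier (M S)\<rbrakk> \<Longrightarrow> \<phi> S S (\<lambda>x\<in>S. x) q = q"
    and map_comp: "\<lbrakk>finite S; finite T; finite U; \<epsilon> \<in> FI_hom S T; \<delta> \<in> FI_hom T U;
        q \<in> carrier (M S)\<rbrakk> \<Longrightarrow>
      \<phi> S U (compose S \<delta> \<epsilon>) q = \<phi> T U \<delta> (\<phi> S T \<epsilon> q)"
    and map_smult: "\<lbrakk>finite R; finite S; finite T; \<eta> \<in> FI_hom R S; \<epsilon> \<in> FI_hom S T;
        a \<in> B R; q \<in> carrier (M S)\<rbrakk> \<Longrightarrow>
      \<phi> S T \<epsilon> (FI_star \<eta> a \<odot>\<^bsub>M S\<^esub> q) = FI_star (compose R \<epsilon> \<eta>) a \<odot>\<^bsub>M T\<^esub> \<phi> S T \<epsilon> q"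

definition FI_submodule ::
    "(nat set \<Rightarrow> 'k::comm_ring_1 FI_poly set) \<Rightarrow> (nat set \<Rightarrow> ('k FI_poly, 'm) module) \<Rightarrow>
     (nat set \<Rightarrow> nat set \<Rightarrow> (nat \<Rightarrow> nat) \<Rightarrow> 'm \<Rightarrow> 'm) \<Rightarrow> (nat set \<Rightarrow> 'm set) \<Rightarrow> bool" where
  "FI_submodule B M \<phi> N \<longleftrightarrow>
     (\<forall>S. finite S \<longrightarrow> submodule (N S) (ring_on (B S)) (M S)) \<and>
     (\<forall>S T. finite S \<longrightarrow> finite T \<longrightarrow> (\<forall>\<epsilon> \<in> FI_hom S T. \<phi> S T \<epsilon> ` N S \<subseteq> N T))"

definition FI_finitely_generated ::
    "(nat set \<Rightarrow> 'k::comm_ring_1 FI_poly set) \<Rightarrow> (nat set \<Rightarrow> ('k FI_poly, 'm) module) \<Rightarrow>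
     (nat set \<Rightarrow> nat set \<Rightarrow> (nat \<Rightarrow> nat) \<Rightarrow> 'm \<Rightarrow> 'm) \<Rightarrow> bool" where
  "FI_finitely_generated B M \<phi> \<longleftrightarrow>
     (\<exists>G. finite G \<and> G \<subseteq> (SIGMA n:UNIV. carrier (M {1..n})) \<and>
       (\<forall>N. FI_submodule B M \<phi> N \<longrightarrow> (\<forall>(n, q) \<in> G. q \<in> N {1..n}) \<longrightarrow>
            (\<forall>S. finite S \<longrightarrow> N S = carrier (M S))))"

text \<open>A submodule \<open>N\<close>, regarded as an FI-module with the operations and maps of \<open>M\<close>.\<close>

definition FI_noetherian ::
    "(nat set \<Rightarrow> 'k::comm_ring_1 FI_poly set) \<Rightarrow> (nat set \<Rightarrow> ('k FI_poly, 'm) module) \<Rightarrow>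
     (nat set \<Rightarrow> nat set \<Rightarrow> (nat \<Rightarrow> nat) \<Rightarrow> 'm \<Rightarrow> 'm) \<Rightarrow> bool" where
  "FI_noetherian B M \<phi> \<longleftrightarrow>
     (\<forall>N. FI_submodule B M \<phi> N \<longrightarrow> FI_finitely_generated B (\<lambda>S. (M S)\<lparr>carrier := N S\<rparr>) \<phi>)"

end

theory Submission
  imports Defs "HOL-Library.Sublist" "HOL-Library.Ramsey" "HOL-Library.Product_Lexorder"
begin

text \<open>
  The proof is a Groebner basis argument carried out inside the module itself, without passing to
  a free module that maps onto it.

  Since \<open>B\<close> is generated by monomials, every \<open>B S\<close> is spanned over \<open>K\<close> by the monomials it contains.
  If \<open>q\<^sub>0, q\<^sub>1, \<dots>\<close> generate \<open>M\<close>, with \<open>q\<^sub>g\<close> of degree \<open>d\<^sub>g\<close>, then \<open>M S\<close> is therefore spanned over \<open>K\<close>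
  by the vectors \<open>x\<^sup>a \<cdot> \<phi>(\<pi>)(q\<^sub>g)\<close>, where \<open>\<pi>\<close> is an injection of \<open>{1..d\<^sub>g}\<close> into \<open>S\<close> and \<open>x\<^sup>a\<close> a monomial of
  \<open>B S\<close> (\<open>Kspan_terms_eq_carrier\<close>). The triples \<open>(g, \<pi>, a)\<close> are called terms. They are totally ordered
  at each \<open>S\<close>, and an operation \<open>q \<mapsto> x\<^sup>\<kappa> \<cdot> \<phi>(\<epsilon>)(q)\<close> sends terms to terms, strictly monotonically
  when \<open>\<epsilon>\<close> is increasing (\<open>rank_act_strict_mono\<close>). Only increasing maps respect an order on the
  variables, which is why they are singled out although \<open>M\<close> is a functor on all injections.

  Two finiteness principles make this work. First, every sequence of terms has a subsequence in
  which each earlier term is carried to each later one by such an operation (\<open>terms_chain\<close>). To see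
  it, read an exponent vector on \<open>{1..n}\<close> as a word of length \<open>n\<close> whose letters are the columns in
  \<open>\<nat>\<^sup>c\<close>, with \<open>\<pi>\<close> recorded in extra rows; Higman's lemma over Dickson's lemma then gives an
  increasing \<open>\<epsilon>\<close> and a monomial \<open>\<kappa>\<close> of the polynomial ring with \<open>a' = \<epsilon>(a) + \<kappa>\<close>. The divisibility
  hypothesis on \<open>B\<close> says exactly that \<open>\<kappa>\<close> again lies in \<open>B\<close>. Secondly, \<open>K\<close> is noetherian, so in a
  sequence of scalars some member lies in the ideal generated by its predecessors.

  Suppose now that a submodule \<open>N\<close> is not finitely generated. Choose \<open>q\<^sub>0, q\<^sub>1, \<dots>\<close> in \<open>N\<close> such that \<open>q\<^sub>i\<close>
  is not in the submodule generated by its predecessors, and has the least possible leading term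
  among such elements over the same finite set. After passing to a subsequence the leading terms
  form a chain, and some leading coefficient, say that of \<open>q\<^sub>i\<close>, lies in the ideal generated by the
  earlier ones. Some element generated by the predecessors then has the same leading term and
  coefficient as \<open>q\<^sub>i\<close>; by minimality their difference is generated by the predecessors, and so is
  \<open>q\<^sub>i\<close>, a contradiction.
\<close>

section \<open>Ascending chains: the lemmas of Dickson and Higman\<close>

lemma nat_seq_mono_subseq:
  fixes f :: "nat \<Rightarrow> nat"
  obtains s :: "nat \<Rightarrow> nat" where "strict_mono s" "mono (\<lambda>n. f (s n))"
proof -
  obtain s where s: "strict_mono s" "monoseq (\<lambda>n. f (s n))"
    using seq_monosub by blast
  show thesis
  proof (cases "\<forall>m n. m \<le> n \<longrightarrow> f (s m) \<le> f (s n)")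
    case True
    then show ?thesis using s(1) that by (auto simp: mono_def)
  next
    case False
    then have dec: "f (s n) \<le> f (s m)" if "m \<le> n" for m n
      using s(2) that unfolding monoseq_def by blast
    obtain k where k: "\<And>n. f (s k) \<le> f (s n)"
      using ex_has_least_nat[of "\<lambda>_. True" 0 "\<lambda>n. f (s n)"] by auto
    have "f (s (n + k)) = f (s k)" for n
      using dec[of k "n + k"] k[of "n + k"] by simp
    moreover have "strict_mono (\<lambda>n. s (n + k))"
      using s(1) by (auto simp: strict_mono_def)
    ultimately show ?thesis using that[of "\<lambda>n. s (n + k)"] by (simp add: mono_def)
  qed
qed

text \<open>
  Restricting to a nondecreasing subsequence one coordinate at a time does not disturb the
  coordinates already treated.
\<close>

lemma Dickson_mono_subseq:
  fixes f :: "nat \<Rightarrow> 'z \<Rightarrow> nat"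
  assumes "finite Z"
  obtains s :: "nat \<Rightarrow> nat" where "strict_mono s" "\<And>z. z \<in> Z \<Longrightarrow> mono (\<lambda>n. f (s n) z)"
proof -
  from assms have "\<exists>s :: nat \<Rightarrow> nat. strict_mono s \<and> (\<forall>z\<in>Z. mono (\<lambda>n. f (s n) z))"
  proof (induction Z)
    case empty
    show ?case by (rule exI[of _ id]) (simp add: strict_mono_def)
  next
    case (insert z Z)
    obtain s :: "nat \<Rightarrow> nat" where s: "strict_mono s" "\<forall>z\<in>Z. mono (\<lambda>n. f (s n) z)"
      using insert.IH by (elim exE conjE)
    obtain t :: "nat \<Rightarrow> nat" where t: "strict_mono t" "mono (\<lambda>n. f (s (t n)) z)"
      using nat_seq_mono_subseq[of "\<lambda>n. f (s n) z"] by blast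
    have "mono t" using t(1) by (rule strict_mono_mono)
    then have "mono (\<lambda>n. f (s (t n)) y)" if "y \<in> Z" for y
      using s(2) that by (auto simp: mono_def)
    moreover have "strict_mono (\<lambda>n. s (t n))"
      using s(1) t(1) by (auto simp: strict_mono_def)
    ultimately show ?case using t(2) by (intro exI[of _ "\<lambda>n. s (t n)"]) auto
  qed
  then show thesis using that by blast
qed

lemma list_emb_index:
  assumes "list_emb P xs ys"
  shows "\<exists>e :: nat \<Rightarrow> nat. strict_mono_on {..<length xs} e \<and>
           (\<forall>i<length xs. e i < length ys \<and> P (xs ! i) (ys ! e i))"
  using assms
proof (induction rule: list_emb.induct)
  case (list_emb_Nil ys)
  show ?case by (simp add: strict_mono_on_def)
next
  case (list_emb_Cons xs ys y)
  then obtain e where "strict_mono_on {..<length xs} e"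
    "\<forall>i<length xs. e i < length ys \<and> P (xs ! i) (ys ! e i)" by blast
  then show ?case
    by (intro exI[of _ "\<lambda>i. Suc (e i)"]) (auto simp: strict_mono_on_def)
next
  case (list_emb_Cons2 x y xs ys)
  then obtain e where e: "strict_mono_on {..<length xs} e"
    "\<forall>i<length xs. e i < length ys \<and> P (xs ! i) (ys ! e i)" by blast
  then show ?case using list_emb_Cons2.hyps
    by (intro exI[of _ "\<lambda>i. case i of 0 \<Rightarrow> 0 | Suc k \<Rightarrow> Suc (e k)"])
       (auto simp: strict_mono_on_def split: nat.splits)
qed

text \<open>
  These are the counterexamples to Higman's lemma.
\<close>

definition bad_words :: "('a \<Rightarrow> 'a \<Rightarrow> bool) \<Rightarrow> (nat \<Rightarrow> 'a list) \<Rightarrow> bool" where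
  "bad_words P w \<longleftrightarrow> (\<forall>i j. i < j \<longrightarrow> \<not> list_emb P (w i) (w j))"

text \<open>
  Nash-Williams' minimal bad sequence: having fixed the first \<open>n\<close> words, take the next one as
  short as any bad continuation permits. The diagonal of the resulting sequence of sequences is
  still bad, since badness only involves two words at a time.
\<close>

lemma minimal_bad_words:
  assumes "bad_words P w0"
  obtains w where "bad_words P w"
    and "\<And>v n. \<lbrakk>bad_words P v; \<And>i. i < n \<Longrightarrow> v i = w i\<rbrakk> \<Longrightarrow> length (w n) \<le> length (v n)"
proof -
  define minat where "minat n W \<longleftrightarrow> bad_words P W \<and>
    (\<forall>V. bad_words P V \<and> (\<forall>i<n. V i = W i) \<longrightarrow> length (W n) \<le> length (V n))" for n W
  have improve: "\<exists>W'. minat n W' \<and> (\<forall>i<n. W' i = W i)" if W: "bad_words P W" for n W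
  proof -
    obtain W' where W': "bad_words P W' \<and> (\<forall>i<n. W' i = W i)"
      and min: "\<And>V. bad_words P V \<and> (\<forall>i<n. V i = W i) \<Longrightarrow> length (W' n) \<le> length (V n)"
      using ex_has_least_nat[of "\<lambda>V. bad_words P V \<and> (\<forall>i<n. V i = W i)" W "\<lambda>V. length (V n)"] W
      by blast
    then show ?thesis unfolding minat_def by (intro exI[of _ W']) auto
  qed
  have "\<exists>F. \<forall>n. minat n (F n) \<and> (\<forall>i<Suc n. F (Suc n) i = F n i)"
  proof (rule dependent_nat_choice)
    show "\<exists>W. minat 0 W" using improve[OF assms, of 0] by blast
    show "\<exists>W'. minat (Suc n) W' \<and> (\<forall>i<Suc n. W' i = W i)" if "minat n W" for W n
      using improve[of W "Suc n"] that by (auto simp: minat_def)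
  qed
  then obtain F where F: "\<And>n. minat n (F n)" "\<And>n i. i < Suc n \<Longrightarrow> F (Suc n) i = F n i" by blast
  have stable: "F (i + k) i = F i i" for i k
    by (induction k) (use F(2) in auto)
  then have stable: "F n i = F i i" if "i \<le> n" for i n
    using that le_Suc_ex by metis
  show thesis
  proof (rule that[of "\<lambda>n. F n n"])
    show "bad_words P (\<lambda>n. F n n)"
      unfolding bad_words_def
    proof (intro allI impI)
      fix i j :: nat assume "i < j"
      moreover have "bad_words P (F j)" using F(1)[of j] by (simp add: minat_def)
      ultimately have "\<not> list_emb P (F j i) (F j j)" by (simp add: bad_words_def)
      then show "\<not> list_emb P (F i i) (F j j)" using stable[of i j] \<open>i < j\<close> by simp
    qed
    fix v n assume "bad_words P v" "\<And>i. i < n \<Longrightarrow> v i = F i i"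
    then have "bad_words P v \<and> (\<forall>i<n. v i = F n i)"
      using stable[OF less_imp_le] by metis
    then show "length (F n n) \<le> length (v n)"
      using F(1)[of n] unfolding minat_def by blast
  qed
qed

text \<open>
  The words of a minimal bad sequence are nonempty. Choose a subsequence whose first letters
  increase and remove these letters, keeping the words that precede the subsequence. A pair in
  the resulting sequence that embeds would yield one in the original, so the new sequence is bad,
  but its first altered word is shorter than minimality permits.
\<close>

lemma Higman:
  fixes P :: "'a \<Rightarrow> 'a \<Rightarrow> bool"
  assumes chain: "\<And>f :: nat \<Rightarrow> 'a. \<exists>s :: nat \<Rightarrow> nat. strict_mono s \<and> (\<forall>i j. i < j \<longrightarrow> P (f (s i)) (f (s j)))"
  shows "\<not> bad_words P w"
proof
  assume "bad_words P w"
  then obtain w where bad: "bad_words P w"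
    and min: "\<And>v n. \<lbrakk>bad_words P v; \<And>i. i < n \<Longrightarrow> v i = w i\<rbrakk> \<Longrightarrow> length (w n) \<le> length (v n)"
    using minimal_bad_words by blast
  have ne: "w i \<noteq> []" for i
    using bad unfolding bad_words_def by (metis lessI list_emb_Nil)
  obtain s :: "nat \<Rightarrow> nat" where s: "strict_mono s"
    and hd: "\<And>i j. i < j \<Longrightarrow> P (hd (w (s i))) (hd (w (s j)))"
    using chain[of "\<lambda>i. hd (w i)"] by blast
  have split: "w i = hd (w i) # tl (w i)" for i using ne[of i] by simp
  define v where "v n = (if n < s 0 then w n else tl (w (s (n - s 0))))" for n
  have le: "s 0 \<le> s k" for k using s by (simp add: strict_mono_less_eq)
  have "bad_words P v"
    unfolding bad_words_def
  proof (intro allI impI notI)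
    fix i j :: nat assume ij: "i < j" and emb: "list_emb P (v i) (v j)"
    consider "j < s 0" | "i < s 0" "s 0 \<le> j" | "s 0 \<le> i" by linarith
    then show False
    proof cases
      case 1
      then show ?thesis using ij emb bad by (simp add: v_def bad_words_def)
    next
      case 2
      then have "list_emb P (w i) (tl (w (s (j - s 0))))" using emb by (simp add: v_def)
      then have "list_emb P (w i) (w (s (j - s 0)))"
        by (subst split) (rule list_emb_Cons)
      moreover have "i < s (j - s 0)" using 2 le[of "j - s 0"] by linarith
      ultimately show ?thesis using bad by (simp add: bad_words_def)
    next
      case 3
      then have "list_emb P (tl (w (s (i - s 0)))) (tl (w (s (j - s 0))))"
        using emb ij by (simp add: v_def)
      moreover have lt: "i - s 0 < j - s 0" using 3 ij by simp
      ultimately have "list_emb P (w (s (i - s 0))) (w (s (j - s 0)))"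
        using hd[OF lt] list_emb_Cons2 split by metis
      moreover have "s (i - s 0) < s (j - s 0)" using lt s by (simp add: strict_mono_less)
      ultimately show ?thesis using bad by (simp add: bad_words_def)
    qed
  qed
  then have "length (w (s 0)) \<le> length (v (s 0))" by (rule min) (simp add: v_def)
  then show False using ne[of "s 0"] by (cases "w (s 0)") (simp_all add: v_def)
qed

text \<open>
  By Ramsey's theorem there is an infinite set of indices on which either all pairs embed or no
  pair does; the second possibility is a bad sequence.
\<close>

lemma Higman_chain:
  fixes P :: "'a \<Rightarrow> 'a \<Rightarrow> bool"
  assumes chain: "\<And>f :: nat \<Rightarrow> 'a. \<exists>s :: nat \<Rightarrow> nat. strict_mono s \<and> (\<forall>i j. i < j \<longrightarrow> P (f (s i)) (f (s j)))"
  obtains s :: "nat \<Rightarrow> nat" where "strict_mono s"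
    "\<And>i j. i < j \<Longrightarrow> list_emb P (w (s i)) (w (s j))"
proof -
  define col where "col X = (if list_emb P (w (Min X)) (w (Max X)) then 0 else 1::nat)" for X :: "nat set"
  have col_less: "infinite (UNIV :: nat set)" "\<forall>x\<in>UNIV. \<forall>y\<in>UNIV. x \<noteq> y \<longrightarrow> col {x, y} < 2"
    by (simp_all add: col_def)
  obtain Y t where Y: "infinite Y" and hom: "\<forall>x\<in>Y. \<forall>y\<in>Y. x \<noteq> y \<longrightarrow> col {x, y} = t"
    using Ramsey2[OF col_less] by (elim exE conjE)
  have sm: "strict_mono (enumerate Y)" using Y by (rule strict_mono_enumerate)
  have col: "col {enumerate Y i, enumerate Y j} = t" if "i < j" for i j
    using hom that sm Y by (simp add: enumerate_in_set strict_mono_eq)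
  have mm: "Min {enumerate Y i, enumerate Y j} = enumerate Y i"
    "Max {enumerate Y i, enumerate Y j} = enumerate Y j" if "i < j" for i j
    using strict_monoD[OF sm that] by auto
  have "t = 0"
  proof (rule ccontr)
    assume "t \<noteq> 0"
    then have "bad_words P (\<lambda>i. w (enumerate Y i))"
      unfolding bad_words_def
    proof (intro allI impI)
      fix i j :: nat assume "i < j"
      from col[OF this] mm[OF this] \<open>t \<noteq> 0\<close>
      show "\<not> list_emb P (w (enumerate Y i)) (w (enumerate Y j))"
        by (simp add: col_def split: if_splits)
    qed
    with Higman[of P, OF chain] show False by (rule notE)
  qed
  have "list_emb P (w (enumerate Y i)) (w (enumerate Y j))" if "i < j" for i j
    using col[OF that] mm[OF that] \<open>t = 0\<close> by (simp add: col_def split: if_splits)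
  then show thesis by (rule that[OF sm])
qed

section \<open>Chains of ideals\<close>

text \<open>
  The ideals generated by the initial segments form a chain, whose union is one of its members.
\<close>

lemma noetherian_ring_seq:
  assumes "noetherian_ring R" and f: "\<And>i :: nat. f i \<in> carrier R"
  shows "\<exists>m. f m \<in> genideal R (f ` {..<m})"
proof -
  interpret noetherian_ring R by fact
  define I where "I m = genideal R (f ` {..<m})" for m
  have sub: "f ` {..<m} \<subseteq> carrier R" for m using f by blast
  have ideal: "ideal (I m) R" for m unfolding I_def by (rule genideal_ideal[OF sub])
  have mono: "I m \<subseteq> I n" if "m \<le> n" for m n
    unfolding I_def using that
    by (intro subset_Idl_subset sub image_mono) auto
  have "subset.chain {I. ideal I R} (range I)"
    unfolding subset_chain_def
  proof (intro conjI ballI)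
    show "range I \<subseteq> {I. ideal I R}" using ideal by blast
    fix J J' assume "J \<in> range I" "J' \<in> range I"
    then obtain i j where "J = I i" "J' = I j" by blast
    then show "J \<subseteq> J' \<or> J' \<subseteq> J" using mono[of i j] mono[of j i] by (cases "i \<le> j") auto
  qed
  then have "\<Union> (range I) \<in> range I" by (intro ideal_chain_is_trivial) auto
  then obtain m where m: "\<Union> (range I) = I m" by blast
  have "f m \<in> I (Suc m)" unfolding I_def using genideal_self[OF sub] by blast
  then show ?thesis using m I_def by blast
qed

section \<open>Exponent vectors\<close>

type_synonym exps = "(nat \<times> nat) \<Rightarrow>\<^sub>0 nat"

abbreviation "lookup \<equiv> Poly_Mapping.lookup"
abbreviation "keys \<equiv> Poly_Mapping.keys"
abbreviation "single \<equiv> Poly_Mapping.single"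

text \<open>
  The action of \<open>\<epsilon>\<^sup>*\<close> on exponent vectors.
\<close>

definition shift :: "(nat \<Rightarrow> nat) \<Rightarrow> exps \<Rightarrow> exps" where
  "shift \<epsilon> a = (\<Sum>v\<in>keys a. single (fst v, \<epsilon> (snd v)) (lookup a v))"

lemma shift_superset:
  assumes "finite A" "keys a \<subseteq> A"
  shows "shift \<epsilon> a = (\<Sum>v\<in>A. single (fst v, \<epsilon> (snd v)) (lookup a v))"
  unfolding shift_def using assms
  by (intro sum.mono_neutral_left) (auto simp: in_keys_iff)

lemma shift_add: "shift \<epsilon> (a + b) = shift \<epsilon> a + shift \<epsilon> b"
proof -
  let ?A = "keys a \<union> keys b"
  have "keys (a + b) \<subseteq> ?A" by (rule Poly_Mapping.keys_add)
  then show ?thesis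
    by (simp add: shift_superset[of ?A] lookup_add single_add sum.distrib)
qed

lemma shift_zero [simp]: "shift \<epsilon> 0 = 0"
  by (simp add: shift_def)

lemma shift_single [simp]: "shift \<epsilon> (single (i, j) n) = single (i, \<epsilon> j) n"
  by (simp add: shift_superset[of "{(i, j)}"])

lemma shift_sum: "shift \<epsilon> (\<Sum>x\<in>A. f x) = (\<Sum>x\<in>A. shift \<epsilon> (f x))"
  by (induction A rule: infinite_finite_induct) (simp_all add: shift_add)

lemma sum_single_lookup: "(\<Sum>v\<in>keys a. single v (lookup a v)) = a"
proof (rule poly_mapping_eqI)
  fix k
  have "lookup (\<Sum>v\<in>keys a. single v (lookup a v)) k = (\<Sum>v\<in>keys a. if v = k then lookup a k else 0)"
    unfolding lookup_sum by (intro sum.cong) (auto simp: lookup_single when_def)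
  then show "lookup (\<Sum>v\<in>keys a. single v (lookup a v)) k = lookup a k"
    by (simp add: in_keys_iff)
qed

lemma shift_ident:
  assumes "\<And>i j. (i, j) \<in> keys a \<Longrightarrow> \<epsilon> j = j"
  shows "shift \<epsilon> a = a"
proof -
  have "shift \<epsilon> a = (\<Sum>v\<in>keys a. single v (lookup a v))"
    unfolding shift_def using assms by (intro sum.cong) auto
  then show ?thesis by (simp add: sum_single_lookup)
qed

lemma keys_shift: "keys (shift \<epsilon> a) \<subseteq> (\<lambda>v. (fst v, \<epsilon> (snd v))) ` keys a"
proof -
  have "keys (shift \<epsilon> a) \<subseteq> (\<Union>v\<in>keys a. keys (single (fst v, \<epsilon> (snd v)) (lookup a v)))"
    unfolding shift_def by (rule keys_sum)
  then show ?thesis by (auto split: if_splits)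
qed

lemma lookup_shift:
  assumes "inj_on \<epsilon> S" "keys a \<subseteq> UNIV \<times> S" "j \<in> S"
  shows "lookup (shift \<epsilon> a) (i, \<epsilon> j) = lookup a (i, j)"
proof -
  have "lookup (shift \<epsilon> a) (i, \<epsilon> j)
      = (\<Sum>v\<in>keys a. if v = (i, j) then lookup a (i, j) else 0)"
    unfolding shift_def lookup_sum using assms
    by (intro sum.cong) (auto simp: lookup_single when_def inj_on_def)
  then show ?thesis by (simp add: in_keys_iff)
qed

lemma lookup_shift_outside:
  assumes "keys a \<subseteq> UNIV \<times> S" "j \<notin> \<epsilon> ` S"
  shows "lookup (shift \<epsilon> a) (i, j) = 0"
proof -
  have "(i, j) \<notin> keys (shift \<epsilon> a)" using keys_shift[of \<epsilon> a] assms by fastforce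
  then show ?thesis by (simp add: in_keys_iff)
qed

lemma less_exps_iff:
  "a < b \<longleftrightarrow> (\<exists>v. lookup a v < lookup b v \<and> (\<forall>u<v. lookup a u = lookup b u))"
  for a b :: exps
  by transfer (simp add: less_fun_def)

lemma exps_le_of_pointwise:
  fixes a b :: exps
  assumes "\<And>v. lookup a v \<le> lookup b v"
  shows "a \<le> b"
proof (rule ccontr)
  assume "\<not> a \<le> b"
  then obtain v where "lookup b v < lookup a v" by (auto simp: not_le less_exps_iff)
  then show False using assms[of v] by simp
qed

text \<open>
  Vectors are compared at the lexicographically first variable at which they differ. An increasing
  \<open>\<epsilon>\<close> preserves the order of the variables \<open>(i, j)\<close> with \<open>j \<in> S\<close>, and both images vanish at the
  variables it misses.
\<close>

lemma shift_strict_mono: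
  assumes lt: "a < b" and mono: "strict_mono_on S \<epsilon>"
    and a: "keys a \<subseteq> UNIV \<times> S" and b: "keys b \<subseteq> UNIV \<times> S"
  shows "shift \<epsilon> a < shift \<epsilon> b"
proof -
  obtain i j where v: "lookup a (i, j) < lookup b (i, j)"
    and below: "\<And>u. u < (i, j) \<Longrightarrow> lookup a u = lookup b u"
    using lt unfolding less_exps_iff by (metis surj_pair)
  have inj: "inj_on \<epsilon> S" using mono by (rule strict_mono_on_imp_inj_on)
  have "(i, j) \<in> keys b" using v by (simp add: in_keys_iff)
  then have j: "j \<in> S" using b by auto
  have "lookup (shift \<epsilon> a) u = lookup (shift \<epsilon> b) u" if u: "u < (i, \<epsilon> j)" for u
  proof (cases "snd u \<in> \<epsilon> ` S")
    case True
    then obtain j' where j': "j' \<in> S" "u = (fst u, \<epsilon> j')" by (metis imageE prod.collapse)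
    then have "fst u < i \<or> fst u = i \<and> \<epsilon> j' < \<epsilon> j" using u by (metis less_prod_def' fst_conv snd_conv)
    then have "(fst u, j') < (i, j)"
      using mono j j'(1) by (auto simp: strict_mono_on_less)
    then show ?thesis
      using below lookup_shift[OF inj a j'(1)] lookup_shift[OF inj b j'(1)] j'(2) by metis
  next
    case False
    then show ?thesis
      using lookup_shift_outside[OF a False, of "fst u"] lookup_shift_outside[OF b False, of "fst u"] by simp
  qed
  moreover have "lookup (shift \<epsilon> a) (i, \<epsilon> j) < lookup (shift \<epsilon> b) (i, \<epsilon> j)"
    using v lookup_shift[OF inj a j] lookup_shift[OF inj b j] by simp
  ultimately show ?thesis unfolding less_exps_iff by blast
qed

section \<open>Monomials and substitutions\<close>

lemma prod_single_one:
  "(\<Prod>x\<in>A. single (g x) (1::'k::comm_ring_1)) = single (\<Sum>x\<in>A. g x) 1"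
  by (induction A rule: infinite_finite_induct) (simp_all add: mult_single)

lemma FI_var_power:
  "FI_var i j ^ n = (single (single (i, j) n) 1 :: 'k::comm_ring_1 FI_poly)"
  by (induction n) (simp_all add: FI_var_def mult_single flip: single_add)

lemma FI_star_eq_sum:
  "FI_star \<epsilon> p = (\<Sum>a\<in>keys p. single (shift \<epsilon> a) (lookup p a))"
proof -
  have "(\<Prod>(i, j)\<in>keys a. FI_var i (\<epsilon> j) ^ lookup a (i, j)) = (single (shift \<epsilon> a) 1 :: 'a FI_poly)" for a
    by (simp add: FI_var_power case_prod_beta prod_single_one shift_def)
  then show ?thesis by (simp add: FI_star_def FI_const_def mult_single)
qed

lemma FI_star_single: "FI_star \<epsilon> (single a k) = single (shift \<epsilon> a) k"
  by (cases "k = 0") (simp_all add: FI_star_eq_sum)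

lemma keys_FI_star: "keys (FI_star \<epsilon> p) \<subseteq> shift \<epsilon> ` keys p"
proof -
  have "keys (FI_star \<epsilon> p) \<subseteq> (\<Union>a\<in>keys p. keys (single (shift \<epsilon> a) (lookup p a)))"
    unfolding FI_star_eq_sum by (rule keys_sum)
  then show ?thesis by (auto split: if_splits)
qed

lemma FI_star_ident:
  assumes "p \<in> FI_P c S"
  shows "FI_star (\<lambda>x\<in>S. x) p = p"
proof -
  have "shift (\<lambda>x\<in>S. x) a = a" if "a \<in> keys p" for a
    using assms that by (intro shift_ident) (auto simp: FI_P_def)
  then show ?thesis by (simp add: FI_star_eq_sum sum_single_lookup)
qed

section \<open>Embeddings of exponent vectors\<close>

text \<open>
  The lexicographic order on all exponent vectors is not well-founded (the variables themselves form an
  infinite descending sequence), but on finitely many variables it is: it extends the pointwise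
  order, so that an infinite descent would contradict Dickson's lemma.
\<close>

lemma finite_support_exps_least:
  fixes A :: "(nat \<times> exps) set"
  assumes Z: "finite Z" and A: "A \<subseteq> UNIV \<times> {b. keys b \<subseteq> Z}" and ne: "A \<noteq> {}"
  obtains m where "m \<in> A" "\<And>x. x \<in> A \<Longrightarrow> m \<le> x"
proof -
  have wf: "wf {(x, y). x < y \<and> x \<in> A \<and> y \<in> A}"
    unfolding wf_iff_no_infinite_down_chain
  proof
    assume "\<exists>f. \<forall>i. (f (Suc i), f i) \<in> {(x, y). x < y \<and> x \<in> A \<and> y \<in> A}"
    then obtain f where f: "\<And>i. f (Suc i) < f i" "\<And>i. f i \<in> A" by auto
    \<comment> \<open>The first component enters as one more coordinate, \<open>None\<close>.\<close>
    define F where "F i z = (case z of None \<Rightarrow> fst (f i) | Some v \<Rightarrow> lookup (snd (f i)) v)" for i z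
    obtain s :: "nat \<Rightarrow> nat" where s: "strict_mono s"
      and mono: "\<And>z. z \<in> insert None (Some ` Z) \<Longrightarrow> mono (\<lambda>i. F (s i) z)"
      using Dickson_mono_subseq[of "insert None (Some ` Z)" F] Z by auto
    have le: "F (s 0) z \<le> F (s 1) z" if "z \<in> insert None (Some ` Z)" for z
      using mono[OF that] by (auto simp: mono_def)
    have "lookup (snd (f (s 0))) v \<le> lookup (snd (f (s 1))) v" for v
    proof (cases "v \<in> Z")
      case True
      then show ?thesis using le[of "Some v"] by (simp add: F_def)
    next
      case False
      then have "v \<notin> keys (snd (f (s 0)))" using subsetD[OF A f(2)[of "s 0"]] by (auto simp: mem_Times_iff)
      then show ?thesis by (simp add: in_keys_iff)
    qed
    then have "snd (f (s 0)) \<le> snd (f (s 1))" by (rule exps_le_of_pointwise)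
    moreover have "fst (f (s 0)) \<le> fst (f (s 1))" using le[of None] by (simp add: F_def)
    ultimately have le01: "f (s 0) \<le> f (s 1)" by (auto simp: less_eq_prod_def)
    have "f (i + Suc k) < f i" for i k
      by (induction k) (use f(1) less_trans in auto)
    moreover obtain k where "s 1 = s 0 + Suc k"
      using less_imp_Suc_add[OF strict_monoD[OF s, of 0 1]] by auto
    ultimately have "f (s 1) < f (s 0)" by metis
    with le01 show False by simp
  qed
  obtain a where "a \<in> A" using ne by blast
  from wfE_min[OF wf this] obtain m where m: "m \<in> A" "\<And>y. (y, m) \<in> {(x, y). x < y \<and> x \<in> A \<and> y \<in> A} \<Longrightarrow> y \<notin> A"
    by blast
  show thesis
  proof (rule that[OF m(1)])
    fix x assume "x \<in> A"
    then have "(x, m) \<notin> {(x, y). x < y \<and> x \<in> A \<and> y \<in> A}" using m(2)[of x] by argo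
    then show "m \<le> x" using m(1) \<open>x \<in> A\<close> by (simp add: not_less)
  qed
qed

text \<open>
  Higman's lemma, applied to the words whose \<open>k\<close>-th letter is the column \<open>(b (1, k), \<dots>, b (C, k))\<close>.
\<close>

lemma exps_column_embedding_chain:
  fixes n :: "nat \<Rightarrow> nat" and b :: "nat \<Rightarrow> exps"
  obtains s :: "nat \<Rightarrow> nat" where "strict_mono s"
    and "\<And>i j. i < j \<Longrightarrow> \<exists>\<epsilon>\<in>FI_hom {1..n (s i)} {1..n (s j)}. strict_mono_on {1..n (s i)} \<epsilon> \<and>
           (\<forall>r\<in>{1..C}. \<forall>k\<in>{1..n (s i)}. lookup (b (s i)) (r, k) \<le> lookup (b (s j)) (r, \<epsilon> k))"
proof -
  define P where "P f g \<longleftrightarrow> (\<forall>r\<in>{1..C}. f r \<le> g r)" for f g :: "nat \<Rightarrow> nat"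
  define w where "w i = map (\<lambda>k r. lookup (b i) (r, k)) [1..<Suc (n i)]" for i
  have len: "length (w i) = n i" for i by (simp add: w_def)
  have "\<exists>s :: nat \<Rightarrow> nat. strict_mono s \<and> (\<forall>i j. i < j \<longrightarrow> P (f (s i)) (f (s j)))"
    for f :: "nat \<Rightarrow> nat \<Rightarrow> nat"
  proof -
    obtain s :: "nat \<Rightarrow> nat" where "strict_mono s" "\<And>r. r \<in> {1..C} \<Longrightarrow> mono (\<lambda>i. f (s i) r)"
      using Dickson_mono_subseq[of "{1..C}" f] by auto
    then show ?thesis by (intro exI[of _ s]) (auto simp: P_def mono_def)
  qed
  then obtain s :: "nat \<Rightarrow> nat" where s: "strict_mono s"
    and emb: "\<And>i j. i < j \<Longrightarrow> list_emb P (w (s i)) (w (s j))"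
    using Higman_chain[of P w] by blast
  show thesis
  proof (rule that[OF s])
    fix i j :: nat assume "i < j"
    from list_emb_index[OF emb[OF this]] obtain e where
      e: "strict_mono_on {..<n (s i)} e"
      and P: "\<And>k. k < n (s i) \<Longrightarrow> e k < n (s j) \<and> P (w (s i) ! k) (w (s j) ! e k)"
      unfolding len by blast
    define \<epsilon> where "\<epsilon> = (\<lambda>k\<in>{1..n (s i)}. Suc (e (k - 1)))"
    have mono: "strict_mono_on {1..n (s i)} \<epsilon>"
    proof (rule strict_mono_onI)
      fix k l assume kl: "k \<in> {1..n (s i)}" "l \<in> {1..n (s i)}" "k < l"
      then have "e (k - 1) < e (l - 1)" by (intro strict_mono_onD[OF e]) auto
      then show "\<epsilon> k < \<epsilon> l" using kl by (simp add: \<epsilon>_def)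
    qed
    have bound: "e (k - 1) < n (s j)" "P (w (s i) ! (k - 1)) (w (s j) ! e (k - 1))"
      if "k \<in> {1..n (s i)}" for k
      using P[of "k - 1"] that by auto
    have "\<epsilon> \<in> {1..n (s i)} \<rightarrow>\<^sub>E {1..n (s j)}"
      using bound(1) unfolding \<epsilon>_def by (auto simp: Suc_le_eq)
    then have "\<epsilon> \<in> FI_hom {1..n (s i)} {1..n (s j)}"
      using strict_mono_on_imp_inj_on[OF mono] by (simp add: FI_hom_def)
    moreover have "lookup (b (s i)) (r, k) \<le> lookup (b (s j)) (r, \<epsilon> k)"
      if "r \<in> {1..C}" "k \<in> {1..n (s i)}" for r k
    proof -
      have "w (s i) ! (k - 1) = (\<lambda>r. lookup (b (s i)) (r, k))"
      proof -
        have "k - 1 < n (s i)" "1 + (k - 1) = k" using that(2) by auto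
        then show ?thesis by (simp add: w_def del: upt_Suc)
      qed
      moreover have "w (s j) ! e (k - 1) = (\<lambda>r. lookup (b (s j)) (r, \<epsilon> k))"
        using bound(1)[OF that(2)] that(2) by (simp add: w_def \<epsilon>_def del: upt_Suc)
      ultimately show ?thesis using bound(2)[OF that(2)] that(1) by (simp add: P_def)
    qed
    ultimately show "\<exists>\<epsilon>\<in>FI_hom {1..n (s i)} {1..n (s j)}. strict_mono_on {1..n (s i)} \<epsilon> \<and>
           (\<forall>r\<in>{1..C}. \<forall>k\<in>{1..n (s i)}. lookup (b (s i)) (r, k) \<le> lookup (b (s j)) (r, \<epsilon> k))"
      using mono by blast
  qed
qed

text \<open>
  The injection \<open>\<pi>\<close> is recorded by \<open>d\<close> further rows below the \<open>c\<close> rows of \<open>a\<close>: row \<open>c + k\<close> has a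
  single entry \<open>1\<close>, in column \<open>\<pi> k\<close>. A column embedding of two such vectors must carry entry to
  entry in these rows and hence intertwines the two injections, and the order on
  exponent vectors becomes an order on pairs \<open>(\<pi>, a)\<close>.
\<close>

definition marked_exps :: "nat \<Rightarrow> nat \<Rightarrow> (nat \<Rightarrow> nat) \<Rightarrow> exps \<Rightarrow> exps" where
  "marked_exps c d \<pi> a = a + (\<Sum>k\<in>{1..d}. single (c + k, \<pi> k) 1)"

lemma lookup_marked_exps:
  "lookup (marked_exps c d \<pi> a) (i, j)
    = lookup a (i, j) + (if i \<in> {c + 1..c + d} \<and> \<pi> (i - c) = j then 1 else 0)"
proof -
  have "lookup (single (c + k, \<pi> k) (1 :: nat)) (i, j)
      = (if k = i - c then if c < i \<and> \<pi> (i - c) = j then 1 else 0 else 0)"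
    if "k \<in> {1..d}" for k
  proof (cases "i = c + k")
    case True
    then show ?thesis using that by (simp add: lookup_single when_def)
  next
    case False
    moreover from this have "k = i - c \<Longrightarrow> \<not> c < i" by simp
    ultimately show ?thesis by (simp add: lookup_single when_def)
  qed
  then have "(\<Sum>k\<in>{1..d}. lookup (single (c + k, \<pi> k) (1 :: nat)) (i, j))
      = (\<Sum>k\<in>{1..d}. if k = i - c then if c < i \<and> \<pi> (i - c) = j then 1 else 0 else 0)"
    by (rule sum.cong[OF refl])
  also have "\<dots> = (if i - c \<in> {1..d} then if c < i \<and> \<pi> (i - c) = j then 1 else 0 else 0)"
    by (rule sum.delta) simp
  also have "\<dots> = (if i \<in> {c + 1..c + d} \<and> \<pi> (i - c) = j then 1 else 0)"
  proof -
    have "i \<in> {c + 1..c + d} \<longleftrightarrow> i - c \<in> {1..d} \<and> c < i" by auto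
    then show ?thesis by argo
  qed
  finally show ?thesis by (simp add: marked_exps_def lookup_add lookup_sum)
qed

lemma keys_marked_exps:
  assumes "keys a \<subseteq> {1..c} \<times> S" "\<pi> \<in> FI_hom {1..d} S"
  shows "keys (marked_exps c d \<pi> a) \<subseteq> {1..c + d} \<times> S"
proof
  fix v assume "v \<in> keys (marked_exps c d \<pi> a)"
  moreover obtain i j where v: "v = (i, j)" by fastforce
  ultimately have "(i, j) \<in> keys a \<or> i \<in> {c + 1..c + d} \<and> \<pi> (i - c) = j"
    by (auto simp: in_keys_iff lookup_marked_exps split: if_splits)
  then show "v \<in> {1..c + d} \<times> S"
  proof
    assume "(i, j) \<in> keys a"
    then show ?thesis using assms(1) v by auto
  next
    assume i: "i \<in> {c + 1..c + d} \<and> \<pi> (i - c) = j"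
    then have "i - c \<in> {1..d}" by auto
    then show ?thesis using i assms(2) v by (auto simp: FI_hom_def)
  qed
qed

lemma marked_exps_compose_shift:
  "marked_exps c d (compose {1..d} \<epsilon> \<pi>) (shift \<epsilon> a + \<kappa>) = shift \<epsilon> (marked_exps c d \<pi> a) + \<kappa>"
  by (simp add: marked_exps_def shift_add shift_sum compose_def add_ac)

text \<open>
  The marker rows force \<open>\<pi>' = \<epsilon> \<circ> \<pi>\<close>, and the first \<open>c\<close> rows say that \<open>a'\<close> is divisible by the image of
  \<open>a\<close>.
\<close>

lemma marked_exps_le_imp_divides:
  assumes \<epsilon>: "\<epsilon> \<in> FI_hom S T"
    and \<pi>: "\<pi> \<in> FI_hom {1..d} S" and a: "keys a \<subseteq> {1..c} \<times> S"
    and \<pi>': "\<pi>' \<in> FI_hom {1..d} T" and a': "keys a' \<subseteq> {1..c} \<times> T"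
    and le: "\<And>i j. \<lbrakk>i \<in> {1..c + d}; j \<in> S\<rbrakk> \<Longrightarrow>
               lookup (marked_exps c d \<pi> a) (i, j) \<le> lookup (marked_exps c d \<pi>' a') (i, \<epsilon> j)"
  shows "\<pi>' = compose {1..d} \<epsilon> \<pi>" and "a' = shift \<epsilon> a + (a' - shift \<epsilon> a)"
    and "keys (a' - shift \<epsilon> a) \<subseteq> {1..c} \<times> T"
proof -
  have inj: "inj_on \<epsilon> S" using \<epsilon> by (simp add: FI_hom_def)
  have low: "lookup (marked_exps c d \<rho> b) (i, j) = lookup b (i, j)" if "i \<in> {1..c}" for \<rho> b i j
    using that by (simp add: lookup_marked_exps)
  show "\<pi>' = compose {1..d} \<epsilon> \<pi>"
  proof
    fix k
    show "\<pi>' k = compose {1..d} \<epsilon> \<pi> k"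
    proof (cases "k \<in> {1..d}")
      case True
      have "(c + k, \<epsilon> (\<pi> k)) \<notin> keys a'" using a' True by auto
      moreover have "\<pi> k \<in> S" using \<pi> True by (auto simp: FI_hom_def)
      ultimately have "(if \<pi>' k = \<epsilon> (\<pi> k) then 1 else 0) \<ge> (1 :: nat)"
        using le[of "c + k" "\<pi> k"] True by (simp add: lookup_marked_exps in_keys_iff)
      then show ?thesis using True by (simp add: compose_def split: if_splits)
    next
      case False
      then have "\<pi>' k = undefined" 
        using PiE_arb[of \<pi>' "{1..d}" "\<lambda>_. T" k] \<pi>' by (simp add: FI_hom_def)
      then show ?thesis using False by (auto simp: compose_def)
    qed
  qed
  have pw: "lookup (shift \<epsilon> a) (i, j) \<le> lookup a' (i, j)" for i j
  proof (cases "(i, j) \<in> keys (shift \<epsilon> a)")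
    case True
    then obtain j' where j': "(i, j') \<in> keys a" "j = \<epsilon> j'" using keys_shift[of \<epsilon> a] by fastforce
    then have ij: "i \<in> {1..c}" "j' \<in> S" using a by auto
    have "lookup (shift \<epsilon> a) (i, j) = lookup a (i, j')"
      unfolding j'(2) using a by (intro lookup_shift[OF inj]) (auto simp: ij(2))
    also have "\<dots> \<le> lookup a' (i, j)"
      using le[of i j'] ij low[of i] j'(2) by simp
    finally show ?thesis .
  next
    case False
    then show ?thesis by (simp add: in_keys_iff)
  qed
  show "a' = shift \<epsilon> a + (a' - shift \<epsilon> a)"
  proof (rule poly_mapping_eqI)
    fix v
    show "lookup a' v = lookup (shift \<epsilon> a + (a' - shift \<epsilon> a)) v"
      using pw[of "fst v" "snd v"] by (simp add: lookup_add lookup_minus)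
  qed
  show "keys (a' - shift \<epsilon> a) \<subseteq> {1..c} \<times> T"
  proof (rule subset_trans[OF _ a'])
    show "keys (a' - shift \<epsilon> a) \<subseteq> keys a'" by (auto simp: in_keys_iff lookup_minus)
  qed
qed

section \<open>Monomial subalgebras\<close>

lemma ring_on_simps [simp]:
  "carrier (ring_on A) = A" "x \<otimes>\<^bsub>ring_on A\<^esub> y = x * y" "x \<oplus>\<^bsub>ring_on A\<^esub> y = x + y"
  "\<one>\<^bsub>ring_on A\<^esub> = 1" "\<zero>\<^bsub>ring_on A\<^esub> = 0"
  by (simp_all add: ring_on_def)

lemma cring_ring_on:
  assumes "0 \<in> A" "1 \<in> A" "\<And>x y. \<lbrakk>x \<in> A; y \<in> A\<rbrakk> \<Longrightarrow> x + y \<in> A"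
    and "\<And>x y. \<lbrakk>x \<in> A; y \<in> A\<rbrakk> \<Longrightarrow> x * y \<in> A" and "\<And>x. x \<in> A \<Longrightarrow> - x \<in> A"
  shows "cring (ring_on A)"
proof (rule cringI)
  show "abelian_group (ring_on A)"
  proof (rule abelian_groupI)
    fix x assume "x \<in> carrier (ring_on A)"
    then show "\<exists>y\<in>carrier (ring_on A). y \<oplus>\<^bsub>ring_on A\<^esub> x = \<zero>\<^bsub>ring_on A\<^esub>"
      using assms by (intro bexI[of _ "- x"]) simp_all
  qed (use assms in \<open>simp_all add: algebra_simps\<close>)
  show "comm_monoid (ring_on A)"
    by (rule comm_monoidI) (use assms in \<open>simp_all add: algebra_simps\<close>)
qed (simp add: algebra_simps)

lemma cring_FI_P: "cring (ring_on (FI_P c S) :: 'k::comm_ring_1 FI_poly ring)"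
proof (rule cring_ring_on)
  fix x y :: "'k FI_poly" assume x: "x \<in> FI_P c S" and y: "y \<in> FI_P c S"
  show "x + y \<in> FI_P c S"
    using x y Poly_Mapping.keys_add[of x y] unfolding FI_P_def by blast
  show "x * y \<in> FI_P c S"
    unfolding FI_P_def
  proof (intro CollectI ballI)
    fix e assume "e \<in> keys (x * y)"
    then obtain a b where e: "e = a + b" "a \<in> keys x" "b \<in> keys y"
      using keys_mult[of x y] by blast
    then have "keys a \<subseteq> {1..c} \<times> S" "keys b \<subseteq> {1..c} \<times> S" using x y by (auto simp: FI_P_def)
    then show "keys e \<subseteq> {1..c} \<times> S" using Poly_Mapping.keys_add[of a b] e(1) by blast
  qed
next
  fix x :: "'k FI_poly" assume "x \<in> FI_P c S"
  then show "- x \<in> FI_P c S" by (simp add: FI_P_def)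
qed (auto simp: FI_P_def)

lemma FI_subalgebraD:
  assumes "FI_subalgebra c B" "finite S"
  shows "B S \<subseteq> FI_P c S" "FI_const k \<in> B S" "0 \<in> B S" "1 \<in> B S"
    and "\<lbrakk>p \<in> B S; p' \<in> B S\<rbrakk> \<Longrightarrow> p + p' \<in> B S"
    and "\<lbrakk>p \<in> B S; p' \<in> B S\<rbrakk> \<Longrightarrow> p * p' \<in> B S"
    and "\<lbrakk>finite T; \<epsilon> \<in> FI_hom S T; p \<in> B S\<rbrakk> \<Longrightarrow> FI_star \<epsilon> p \<in> B T"
proof -
  have sub: "subring (B S) (ring_on (FI_P c S))" and const: "\<And>k. FI_const k \<in> B S"
    using assms by (auto simp: FI_subalgebra_def)
  show "B S \<subseteq> FI_P c S" using subringE(1)[OF sub] by simp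
  show "FI_const k \<in> B S" by (rule const)
  show "0 \<in> B S" using subringE(2)[OF sub] by simp
  show "1 \<in> B S" using subringE(3)[OF sub] by simp
  show "\<lbrakk>p \<in> B S; p' \<in> B S\<rbrakk> \<Longrightarrow> p + p' \<in> B S" using subringE(7)[OF sub, of p p'] by simp
  show "\<lbrakk>p \<in> B S; p' \<in> B S\<rbrakk> \<Longrightarrow> p * p' \<in> B S" using subringE(6)[OF sub, of p p'] by simp
  show "\<lbrakk>finite T; \<epsilon> \<in> FI_hom S T; p \<in> B S\<rbrakk> \<Longrightarrow> FI_star \<epsilon> p \<in> B T"
  proof -
    assume "finite T" "\<epsilon> \<in> FI_hom S T" "p \<in> B S"
    then have "FI_star \<epsilon> ` B S \<subseteq> B T" using assms by (simp add: FI_subalgebra_def)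
    then show "FI_star \<epsilon> p \<in> B T" using \<open>p \<in> B S\<close> by (rule subsetD[OF _ imageI])
  qed
qed

lemma single_eq_const_mult: "single a k = FI_const k * single a 1"
  by (simp add: FI_const_def mult_single)

text \<open>
  The polynomials all of whose monomials lie in \<open>B S\<close> form a subalgebra of \<open>B\<close> that contains
  the generators, hence all of \<open>B\<close>.
\<close>

lemma monomials_of_monomially_generated:
  fixes B :: "nat set \<Rightarrow> 'k::comm_ring_1 FI_poly set"
  assumes B: "FI_subalgebra c B"
    and mono: "\<forall>(n, f)\<in>G. FI_monomial f" and gen: "FI_algebra_generated_by c B G"
    and S: "finite S" and p: "p \<in> B S" and a: "a \<in> keys p"
  shows "single a 1 \<in> B S"
proof -
  note BD = FI_subalgebraD[OF B]
  define C :: "nat set \<Rightarrow> 'k FI_poly set"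
    where "C S = {p \<in> FI_P c S. \<forall>a\<in>keys p. single a 1 \<in> B S}" for S
  have "C S \<subseteq> B S" if S: "finite S" for S
  proof
    fix p assume p: "p \<in> C S"
    have "(\<Sum>a\<in>A. single a (lookup p a)) \<in> B S" if "finite A" "A \<subseteq> keys p" for A
      using that
    proof (induction A)
      case empty
      show ?case using BD(3)[OF S] by simp
    next
      case (insert a A)
      then have "single a (1 :: 'k) \<in> B S" using p by (simp add: C_def)
      then have "single a (lookup p a) \<in> B S"
        using BD(6)[OF S] BD(2)[OF S] single_eq_const_mult[of a "lookup p a"] by metis
      then show ?case using insert BD(5)[OF S] by simp
    qed
    from this[of "keys p"] show "p \<in> B S" by (simp add: sum_single_lookup)
  qed
  moreover have "FI_subalgebra c C"
    unfolding FI_subalgebra_def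
  proof (intro conjI allI impI ballI)
    fix S :: "nat set" assume S: "finite S"
    interpret P: cring "ring_on (FI_P c S) :: 'k FI_poly ring" by (rule cring_FI_P)
    show const: "FI_const k \<in> C S" for k
      using BD(4)[OF S] by (auto simp: C_def FI_const_def FI_P_def split: if_splits)
    have mult: "p * p' \<in> C S" if "p \<in> C S" "p' \<in> C S" for p p'
      unfolding C_def
    proof (intro CollectI conjI ballI)
      show "p * p' \<in> FI_P c S" using P.m_closed[of p p'] that by (simp add: C_def)
      fix e assume "e \<in> keys (p * p')"
      then obtain a b where e: "e = a + b" "a \<in> keys p" "b \<in> keys p'"
        using keys_mult[of p p'] by blast
      then have "single a (1 :: 'k) * single b 1 \<in> B S"
        using that BD(6)[OF S] by (simp add: C_def)
      then show "single e (1 :: 'k) \<in> B S" by (simp add: mult_single e(1))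
    qed
    have neg: "\<ominus>\<^bsub>ring_on (FI_P c S)\<^esub> p = - p" if "p \<in> FI_P c S" for p :: "'k FI_poly"
      using that by (intro P.minus_equality) (auto simp: FI_P_def)
    show "subring (C S) (ring_on (FI_P c S))"
    proof (rule P.subringI)
      show "C S \<subseteq> carrier (ring_on (FI_P c S))" by (auto simp: C_def)
      show "\<one>\<^bsub>ring_on (FI_P c S)\<^esub> \<in> C S" using const[of 1] by (simp add: FI_const_def)
      fix p p' assume p: "p \<in> C S" and p': "p' \<in> C S"
      show "\<ominus>\<^bsub>ring_on (FI_P c S)\<^esub> p \<in> C S"
        using p neg[of p] by (auto simp: C_def FI_P_def)
      show "p \<otimes>\<^bsub>ring_on (FI_P c S)\<^esub> p' \<in> C S" using mult p p' by simp
      have "p + p' \<in> FI_P c S" using P.a_closed[of p p'] p p' by (simp add: C_def)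
      then show "p \<oplus>\<^bsub>ring_on (FI_P c S)\<^esub> p' \<in> C S"
        using p p' Poly_Mapping.keys_add[of p p'] by (auto simp: C_def)
    qed
  next
    fix S T :: "nat set" and \<epsilon> assume S: "finite S" and T: "finite T" and \<epsilon>: "\<epsilon> \<in> FI_hom S T"
    show "FI_star \<epsilon> ` C S \<subseteq> C T"
    proof
      fix r assume "r \<in> FI_star \<epsilon> ` C S"
      then obtain p where p: "p \<in> C S" "r = FI_star \<epsilon> p" by blast
      have "single b (1 :: 'k) \<in> B T \<and> keys b \<subseteq> {1..c} \<times> T" if b: "b \<in> keys r" for b
      proof -
        obtain a where a: "a \<in> keys p" "b = shift \<epsilon> a" using b keys_FI_star[of \<epsilon> p] p(2) by blast
        then have "FI_star \<epsilon> (single a (1 :: 'k)) \<in> B T"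
          using p(1) BD(7)[OF S T \<epsilon>] by (simp add: C_def)
        moreover have "keys a \<subseteq> {1..c} \<times> S" using p(1) a(1) by (auto simp: C_def FI_P_def)
        then have "keys b \<subseteq> {1..c} \<times> T"
          using keys_shift[of \<epsilon> a] a(2) \<epsilon> by (fastforce simp: FI_hom_def)
        ultimately show ?thesis using a(2) by (simp add: FI_star_single)
      qed
      then show "r \<in> C T" by (simp add: C_def FI_P_def)
    qed
  qed
  moreover have "\<forall>(n, f)\<in>G. f \<in> C {1..n}"
  proof (intro ballI, clarify)
    fix n f assume nf: "(n, f) \<in> G"
    then have f: "f \<in> B {1..n}" using gen by (auto simp: FI_algebra_generated_by_def)
    obtain a where "f = single a 1" using mono nf by (auto simp: FI_monomial_def)
    then show "f \<in> C {1..n}"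
      using f BD(1)[of "{1..n}"] by (auto simp: C_def split: if_splits)
  qed
  ultimately have "C S = B S"
    using gen S unfolding FI_algebra_generated_by_def by blast
  then show ?thesis using p a by (auto simp: C_def)
qed

section \<open>Spans of monomial vectors\<close>

text \<open>
  The list \<open>gs\<close> is a numbering of a finite generating set; the numbers will be compared when terms
  are ordered.
\<close>

locale monomial_FI_module = FI_module B M \<phi>
  for B :: "nat set \<Rightarrow> 'k::comm_ring_1 FI_poly set"
    and M :: "nat set \<Rightarrow> ('k FI_poly, 'm) module"
    and \<phi> :: "nat set \<Rightarrow> nat set \<Rightarrow> (nat \<Rightarrow> nat) \<Rightarrow> 'm \<Rightarrow> 'm" +
  fixes c :: nat and gs :: "(nat \<times> 'm) list"
  assumes subalgebra: "FI_subalgebra c B"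
    and monomials_in: "\<lbrakk>finite S; p \<in> B S; a \<in> keys p\<rbrakk> \<Longrightarrow> single a 1 \<in> B S"
    and generators_in: "(n, q) \<in> set gs \<Longrightarrow> q \<in> carrier (M {1..n})"
    and generators: "\<lbrakk>FI_submodule B M \<phi> N; \<And>n q. (n, q) \<in> set gs \<Longrightarrow> q \<in> N {1..n}; finite S\<rbrakk>
                       \<Longrightarrow> N S = carrier (M S)"
begin

lemmas B = FI_subalgebraD[OF subalgebra]

lemma module_rules:
  assumes S: "finite S"
  shows "abelian_group (M S)"
    and "\<lbrakk>p \<in> B S; q \<in> carrier (M S)\<rbrakk> \<Longrightarrow> p \<odot>\<^bsub>M S\<^esub> q \<in> carrier (M S)"
    and "\<lbrakk>p \<in> B S; p' \<in> B S; q \<in> carrier (M S)\<rbrakk> \<Longrightarrow>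
           (p + p') \<odot>\<^bsub>M S\<^esub> q = p \<odot>\<^bsub>M S\<^esub> q \<oplus>\<^bsub>M S\<^esub> p' \<odot>\<^bsub>M S\<^esub> q"
    and "\<lbrakk>p \<in> B S; q \<in> carrier (M S); q' \<in> carrier (M S)\<rbrakk> \<Longrightarrow>
           p \<odot>\<^bsub>M S\<^esub> (q \<oplus>\<^bsub>M S\<^esub> q') = p \<odot>\<^bsub>M S\<^esub> q \<oplus>\<^bsub>M S\<^esub> p \<odot>\<^bsub>M S\<^esub> q'"
    and "\<lbrakk>p \<in> B S; p' \<in> B S; q \<in> carrier (M S)\<rbrakk> \<Longrightarrow>
           p \<odot>\<^bsub>M S\<^esub> (p' \<odot>\<^bsub>M S\<^esub> q) = (p * p') \<odot>\<^bsub>M S\<^esub> q"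
    and "q \<in> carrier (M S) \<Longrightarrow> 1 \<odot>\<^bsub>M S\<^esub> q = q"
    and "q \<in> carrier (M S) \<Longrightarrow> 0 \<odot>\<^bsub>M S\<^esub> q = \<zero>\<^bsub>M S\<^esub>"
    and "p \<in> B S \<Longrightarrow> p \<odot>\<^bsub>M S\<^esub> \<zero>\<^bsub>M S\<^esub> = \<zero>\<^bsub>M S\<^esub>"
    and "q \<in> carrier (M S) \<Longrightarrow> \<ominus>\<^bsub>M S\<^esub> q = FI_const (- 1) \<odot>\<^bsub>M S\<^esub> q"
proof -
  interpret module "ring_on (B S)" "M S" using module_over_B[OF S] .
  show "abelian_group (M S)" ..
  show closed: "p \<odot>\<^bsub>M S\<^esub> q \<in> carrier (M S)" if "p \<in> B S" "q \<in> carrier (M S)" for p q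
    using that smult_closed by simp
  show add: "(p + p') \<odot>\<^bsub>M S\<^esub> q = p \<odot>\<^bsub>M S\<^esub> q \<oplus>\<^bsub>M S\<^esub> p' \<odot>\<^bsub>M S\<^esub> q"
    if "p \<in> B S" "p' \<in> B S" "q \<in> carrier (M S)" for p p' q
    using that smult_l_distr[of p p' q] by simp
  show "p \<odot>\<^bsub>M S\<^esub> (q \<oplus>\<^bsub>M S\<^esub> q') = p \<odot>\<^bsub>M S\<^esub> q \<oplus>\<^bsub>M S\<^esub> p \<odot>\<^bsub>M S\<^esub> q'"
    if "p \<in> B S" "q \<in> carrier (M S)" "q' \<in> carrier (M S)"
    using that smult_r_distr[of p q q'] by simp
  show "p \<odot>\<^bsub>M S\<^esub> (p' \<odot>\<^bsub>M S\<^esub> q) = (p * p') \<odot>\<^bsub>M S\<^esub> q"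
    if "p \<in> B S" "p' \<in> B S" "q \<in> carrier (M S)"
    using that smult_assoc1[of p p' q] by simp
  show one: "1 \<odot>\<^bsub>M S\<^esub> q = q" if "q \<in> carrier (M S)" for q
    using that smult_one[of q] by simp
  show null: "0 \<odot>\<^bsub>M S\<^esub> q = \<zero>\<^bsub>M S\<^esub>" if "q \<in> carrier (M S)" for q
    using that smult_l_null[of q] by simp
  show "p \<odot>\<^bsub>M S\<^esub> \<zero>\<^bsub>M S\<^esub> = \<zero>\<^bsub>M S\<^esub>" if "p \<in> B S"
    using that smult_r_null[of p] by simp
  show "\<ominus>\<^bsub>M S\<^esub> q = FI_const (- 1) \<odot>\<^bsub>M S\<^esub> q" if q: "q \<in> carrier (M S)"
  proof (rule M.minus_equality)
    have "FI_const (- 1) + (1 :: 'k FI_poly) = 0"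
      unfolding FI_const_def by (simp flip: single_one single_add)
    then show "FI_const (- 1) \<odot>\<^bsub>M S\<^esub> q \<oplus>\<^bsub>M S\<^esub> q = \<zero>\<^bsub>M S\<^esub>"
      using add[OF B(2)[OF S, of "- 1"] B(4)[OF S] q] one[OF q] null[OF q] by simp
  qed (use q closed[OF B(2)[OF S]] in auto)
qed

lemma map_rules:
  assumes "finite S" "finite T" "\<epsilon> \<in> FI_hom S T"
  shows "q \<in> carrier (M S) \<Longrightarrow> \<phi> S T \<epsilon> q \<in> carrier (M T)"
    and "\<lbrakk>q \<in> carrier (M S); q' \<in> carrier (M S)\<rbrakk> \<Longrightarrow>
           \<phi> S T \<epsilon> (q \<oplus>\<^bsub>M S\<^esub> q') = \<phi> S T \<epsilon> q \<oplus>\<^bsub>M T\<^esub> \<phi> S T \<epsilon> q'"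
    and "\<phi> S T \<epsilon> \<zero>\<^bsub>M S\<^esub> = \<zero>\<^bsub>M T\<^esub>"
proof -
  have h: "\<phi> S T \<epsilon> \<in> hom (add_monoid (M S)) (add_monoid (M T))"
    using map_hom[OF assms] .
  show "\<phi> S T \<epsilon> q \<in> carrier (M T)" if "q \<in> carrier (M S)"
    using hom_in_carrier[OF h] that by simp
  show "\<phi> S T \<epsilon> (q \<oplus>\<^bsub>M S\<^esub> q') = \<phi> S T \<epsilon> q \<oplus>\<^bsub>M T\<^esub> \<phi> S T \<epsilon> q'"
    if "q \<in> carrier (M S)" "q' \<in> carrier (M S)"
    using hom_mult[OF h, of q q'] that by simp
  have "group (add_monoid (M S))" "group (add_monoid (M T))"
    using module_rules(1)[OF assms(1)] module_rules(1)[OF assms(2)]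
    by (auto simp: abelian_group.a_group)
  then show "\<phi> S T \<epsilon> \<zero>\<^bsub>M S\<^esub> = \<zero>\<^bsub>M T\<^esub>"
    using hom_one[OF h] by simp
qed

text \<open>
  Semilinearity of \<open>\<phi> S T \<epsilon>\<close>, which the axioms state for scalars of the form \<open>\<eta>\<^sup>*(p)\<close>, with \<open>\<eta>\<close>
  taken to be the identity.
\<close>

lemma map_smult':
  assumes S: "finite S" and T: "finite T" and \<epsilon>: "\<epsilon> \<in> FI_hom S T" and p: "p \<in> B S"
    and q: "q \<in> carrier (M S)"
  shows "\<phi> S T \<epsilon> (p \<odot>\<^bsub>M S\<^esub> q) = FI_star \<epsilon> p \<odot>\<^bsub>M T\<^esub> \<phi> S T \<epsilon> q"
proof -
  have "(\<lambda>x\<in>S. x) \<in> FI_hom S S" by (auto simp: FI_hom_def inj_on_def)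
  moreover have "compose S \<epsilon> (\<lambda>x\<in>S. x) = \<epsilon>"
    using \<epsilon> by (auto simp: compose_def FI_hom_def PiE_def extensional_def)
  moreover have "FI_star (\<lambda>x\<in>S. x) p = p" using FI_star_ident B(1)[OF S] p by blast
  ultimately show ?thesis using map_smult[OF S S T _ \<epsilon> p q] by metis
qed

lemma FI_submoduleI:
  assumes "\<And>S. finite S \<Longrightarrow> N S \<subseteq> carrier (M S)" "\<And>S. finite S \<Longrightarrow> \<zero>\<^bsub>M S\<^esub> \<in> N S"
    and "\<And>S q q'. \<lbrakk>finite S; q \<in> N S; q' \<in> N S\<rbrakk> \<Longrightarrow> q \<oplus>\<^bsub>M S\<^esub> q' \<in> N S"
    and smult: "\<And>S p q. \<lbrakk>finite S; p \<in> B S; q \<in> N S\<rbrakk> \<Longrightarrow> p \<odot>\<^bsub>M S\<^esub> q \<in> N S"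
    and map: "\<And>S T \<epsilon> q. \<lbrakk>finite S; finite T; \<epsilon> \<in> FI_hom S T; q \<in> N S\<rbrakk> \<Longrightarrow> \<phi> S T \<epsilon> q \<in> N T"
  shows "FI_submodule B M \<phi> N"
  unfolding FI_submodule_def
proof (intro conjI allI impI ballI)
  fix S :: "nat set" assume S: "finite S"
  interpret module "ring_on (B S)" "M S" using module_over_B[OF S] .
  show "submodule (N S) (ring_on (B S)) (M S)"
  proof (rule submoduleI)
    fix q assume q: "q \<in> N S"
    then have "FI_const (- 1) \<odot>\<^bsub>M S\<^esub> q \<in> N S" using smult[OF S B(2)[OF S]] by blast
    then show "\<ominus>\<^bsub>M S\<^esub> q \<in> N S" using module_rules(9)[OF S, of q] q assms(1)[OF S] by auto
  qed (use assms S in auto)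
qed (use map in blast)

lemma FI_submoduleD:
  assumes N: "FI_submodule B M \<phi> N" and S: "finite S"
  shows "N S \<subseteq> carrier (M S)" "\<zero>\<^bsub>M S\<^esub> \<in> N S"
    and "\<lbrakk>q \<in> N S; q' \<in> N S\<rbrakk> \<Longrightarrow> q \<oplus>\<^bsub>M S\<^esub> q' \<in> N S"
    and "\<lbrakk>p \<in> B S; q \<in> N S\<rbrakk> \<Longrightarrow> p \<odot>\<^bsub>M S\<^esub> q \<in> N S"
    and "q \<in> N S \<Longrightarrow> \<ominus>\<^bsub>M S\<^esub> q \<in> N S"
    and "\<lbrakk>finite T; \<epsilon> \<in> FI_hom S T; q \<in> N S\<rbrakk> \<Longrightarrow> \<phi> S T \<epsilon> q \<in> N T"
proof -
  have sub: "submodule (N S) (ring_on (B S)) (M S)" using N S by (simp add: FI_submodule_def)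
  interpret module "ring_on (B S)" "M S" using module_over_B[OF S] .
  note E = submoduleE[OF sub]
  show "N S \<subseteq> carrier (M S)" by (rule E(1))
  show "\<zero>\<^bsub>M S\<^esub> \<in> N S"
    using subgroup.one_closed[OF submodule.axioms(1)[OF sub]] by simp
  show "q \<oplus>\<^bsub>M S\<^esub> q' \<in> N S" if "q \<in> N S" "q' \<in> N S" using E(5) that by blast
  show "p \<odot>\<^bsub>M S\<^esub> q \<in> N S" if "p \<in> B S" "q \<in> N S" using E(4)[of p q] that by simp
  show "\<ominus>\<^bsub>M S\<^esub> q \<in> N S" if "q \<in> N S" using E(3) that by blast
  show "\<phi> S T \<epsilon> q \<in> N T" if "finite T" "\<epsilon> \<in> FI_hom S T" "q \<in> N S"
  proof -
    have "\<phi> S T \<epsilon> ` N S \<subseteq> N T" using N S that by (simp add: FI_submodule_def)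
    then show ?thesis using that(3) by (rule subsetD[OF _ imageI])
  qed
qed

text \<open>
  The \<open>K\<close>-linear span of \<open>V\<close> in \<open>M S\<close>, generated one summand at a time so that leading terms can be
  found by induction.
\<close>

inductive_set Kspan :: "nat set \<Rightarrow> 'm set \<Rightarrow> 'm set" for S V where
  zero: "\<zero>\<^bsub>M S\<^esub> \<in> Kspan S V"
| add: "\<lbrakk>v \<in> V; q \<in> Kspan S V\<rbrakk> \<Longrightarrow> FI_const k \<odot>\<^bsub>M S\<^esub> v \<oplus>\<^bsub>M S\<^esub> q \<in> Kspan S V"

lemma Kspan_mono: "q \<in> Kspan S V \<Longrightarrow> V \<subseteq> W \<Longrightarrow> q \<in> Kspan S W"
  by (induction rule: Kspan.induct) (auto intro: Kspan.intros)

lemma Kspan_carrier: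
  assumes S: "finite S" and V: "V \<subseteq> carrier (M S)"
  shows "Kspan S V \<subseteq> carrier (M S)"
proof
  interpret abelian_group "M S" using module_rules(1)[OF S] .
  fix q assume "q \<in> Kspan S V"
  then show "q \<in> carrier (M S)"
    by (induction rule: Kspan.induct) (use V B(2)[OF S] module_rules(2)[OF S] in auto)
qed

lemma Kspan_hom:
  assumes S: "finite S" and T: "finite T" and V: "V \<subseteq> carrier (M S)"
    and zero: "h \<zero>\<^bsub>M S\<^esub> = \<zero>\<^bsub>M T\<^esub>"
    and add: "\<And>q q'. \<lbrakk>q \<in> carrier (M S); q' \<in> carrier (M S)\<rbrakk> \<Longrightarrow>
                h (q \<oplus>\<^bsub>M S\<^esub> q') = h q \<oplus>\<^bsub>M T\<^esub> h q'"
    and const: "\<And>k v. v \<in> V \<Longrightarrow> h (FI_const k \<odot>\<^bsub>M S\<^esub> v) = FI_const k \<odot>\<^bsub>M T\<^esub> h v"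
    and into: "\<And>v. v \<in> V \<Longrightarrow> h v \<in> W"
    and q: "q \<in> Kspan S V"
  shows "h q \<in> Kspan T W"
  using q
proof (induction rule: Kspan.induct)
  case zero
  show ?case using assms(4) by (simp add: Kspan.zero)
next
  case (add v q k)
  have "FI_const k \<odot>\<^bsub>M S\<^esub> v \<in> carrier (M S)" "q \<in> carrier (M S)"
    using add.hyps V Kspan_carrier[OF S V] module_rules(2)[OF S B(2)[OF S]] by auto
  then show ?case using assms(5) const[OF add.hyps(1)] Kspan.add[OF into[OF add.hyps(1)] add.IH]
    by simp
qed

lemma Kspan_add:
  assumes S: "finite S" and V: "V \<subseteq> carrier (M S)" and q: "q \<in> Kspan S V" and q': "q' \<in> Kspan S V"
  shows "q \<oplus>\<^bsub>M S\<^esub> q' \<in> Kspan S V"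
proof -
  interpret abelian_group "M S" using module_rules(1)[OF S] .
  have c': "q' \<in> carrier (M S)" using q' Kspan_carrier[OF S V] by blast
  from q show ?thesis
  proof (induction rule: Kspan.induct)
    case zero
    then show ?case using q' c' by simp
  next
    case (add v q k)
    have "FI_const k \<odot>\<^bsub>M S\<^esub> v \<in> carrier (M S)" "q \<in> carrier (M S)"
      using add.hyps V Kspan_carrier[OF S V] module_rules(2)[OF S B(2)[OF S]] by auto
    then show ?case using Kspan.add[OF add.hyps(1) add.IH, of k] c' by (simp add: a_assoc)
  qed
qed

lemma Kspan_const_smult:
  assumes S: "finite S" and V: "V \<subseteq> carrier (M S)" and q: "q \<in> Kspan S V"
  shows "FI_const k \<odot>\<^bsub>M S\<^esub> q \<in> Kspan S V"
  using q
proof (induction rule: Kspan.induct)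
  case zero
  show ?case using module_rules(8)[OF S B(2)[OF S]] by (simp add: Kspan.zero)
next
  case (add v q l)
  have "v \<in> carrier (M S)" "q \<in> carrier (M S)"
    using add.hyps V Kspan_carrier[OF S V] by auto
  then have "FI_const k \<odot>\<^bsub>M S\<^esub> (FI_const l \<odot>\<^bsub>M S\<^esub> v \<oplus>\<^bsub>M S\<^esub> q)
      = FI_const (k * l) \<odot>\<^bsub>M S\<^esub> v \<oplus>\<^bsub>M S\<^esub> FI_const k \<odot>\<^bsub>M S\<^esub> q"
    using module_rules(2,4,5)[OF S] B(2)[OF S] by (simp add: FI_const_def mult_single)
  then show ?case using Kspan.add[OF add.hyps(1) add.IH] by simp
qed

lemma Kspan_base:
  assumes S: "finite S" and V: "V \<subseteq> carrier (M S)" and v: "v \<in> V"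
  shows "v \<in> Kspan S V"
proof -
  interpret abelian_group "M S" using module_rules(1)[OF S] .
  have "v \<in> carrier (M S)" using V v by blast
  then have "FI_const 1 \<odot>\<^bsub>M S\<^esub> v \<oplus>\<^bsub>M S\<^esub> \<zero>\<^bsub>M S\<^esub> = v"
    using module_rules(6)[OF S] by (simp add: FI_const_def)
  then show ?thesis using Kspan.add[OF v Kspan.zero, of S 1] by simp
qed

definition Mon :: "nat set \<Rightarrow> exps set" where
  "Mon S = {a. keys a \<subseteq> {1..c} \<times> S \<and> single a (1 :: 'k) \<in> B S}"

abbreviation deg :: "nat \<Rightarrow> nat" where "deg g \<equiv> fst (gs ! g)"

definition terms :: "nat set \<Rightarrow> (nat \<times> (nat \<Rightarrow> nat) \<times> exps) set" where
  "terms S = {(g, \<pi>, a). g < length gs \<and> \<pi> \<in> FI_hom {1..deg g} S \<and> a \<in> Mon S}"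

definition vec :: "nat set \<Rightarrow> nat \<times> (nat \<Rightarrow> nat) \<times> exps \<Rightarrow> 'm" where
  "vec S = (\<lambda>(g, \<pi>, a). single a 1 \<odot>\<^bsub>M S\<^esub> \<phi> {1..deg g} S \<pi> (snd (gs ! g)))"

text \<open>
  The effect of \<open>q \<mapsto> x\<^sup>\<kappa> \<cdot> \<phi>(\<epsilon>)(q)\<close> on terms; see \<open>vec_act\<close>.
\<close>

definition act :: "(nat \<Rightarrow> nat) \<Rightarrow> exps \<Rightarrow> nat \<times> (nat \<Rightarrow> nat) \<times> exps \<Rightarrow> nat \<times> (nat \<Rightarrow> nat) \<times> exps" where
  "act \<epsilon> \<kappa> = (\<lambda>(g, \<pi>, a). (g, compose {1..deg g} \<epsilon> \<pi>, shift \<epsilon> a + \<kappa>))"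

lemma Mon_add:
  assumes "finite S" "a \<in> Mon S" "b \<in> Mon S"
  shows "a + b \<in> Mon S"
proof -
  have "single a (1 :: 'k) * single b 1 \<in> B S" using assms B(6) by (simp add: Mon_def)
  then show ?thesis
    using assms Poly_Mapping.keys_add[of a b] by (fastforce simp: Mon_def mult_single)
qed

lemma Mon_shift:
  assumes S: "finite S" and T: "finite T" and \<epsilon>: "\<epsilon> \<in> FI_hom S T" and a: "a \<in> Mon S"
  shows "shift \<epsilon> a \<in> Mon T"
proof -
  have "FI_star \<epsilon> (single a (1 :: 'k)) \<in> B T" using a B(7)[OF S T \<epsilon>] by (simp add: Mon_def)
  moreover have "keys (shift \<epsilon> a) \<subseteq> {1..c} \<times> T"
    using keys_shift[of \<epsilon> a] a \<epsilon> by (fastforce simp: Mon_def FI_hom_def)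
  ultimately show ?thesis by (simp add: Mon_def FI_star_single)
qed

lemma FI_hom_compose:
  assumes "\<pi> \<in> FI_hom R S" "\<epsilon> \<in> FI_hom S T"
  shows "compose R \<epsilon> \<pi> \<in> FI_hom R T"
  using assms unfolding FI_hom_def by (auto simp: compose_def inj_on_def PiE_def Pi_def)

lemma act_in_terms:
  assumes "finite S" "finite T" "\<epsilon> \<in> FI_hom S T" "\<kappa> \<in> Mon T" "x \<in> terms S"
  shows "act \<epsilon> \<kappa> x \<in> terms T"
  using assms Mon_add[OF assms(2)] Mon_shift[OF assms(1-3)]
  by (auto simp: terms_def act_def FI_hom_compose)

lemma generator_in: "g < length gs \<Longrightarrow> snd (gs ! g) \<in> carrier (M {1..deg g})"
  using generators_in[of "deg g" "snd (gs ! g)"] by simp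

lemma vec_carrier:
  assumes "finite S" "x \<in> terms S"
  shows "vec S x \<in> carrier (M S)"
  using assms generator_in map_rules(1)[OF _ assms(1)] module_rules(2)[OF assms(1)]
  by (auto simp: terms_def vec_def Mon_def)

lemma vec_image_carrier: "finite S \<Longrightarrow> Y \<subseteq> terms S \<Longrightarrow> vec S ` Y \<subseteq> carrier (M S)"
  using vec_carrier by blast

lemma vec_act:
  assumes S: "finite S" and T: "finite T" and \<epsilon>: "\<epsilon> \<in> FI_hom S T" and \<kappa>: "\<kappa> \<in> Mon T"
    and x: "x \<in> terms S"
  shows "single \<kappa> 1 \<odot>\<^bsub>M T\<^esub> \<phi> S T \<epsilon> (vec S x) = vec T (act \<epsilon> \<kappa> x)"
proof -
  obtain g \<pi> a where x_eq: "x = (g, \<pi>, a)" by (cases x)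
  have g: "g < length gs" and \<pi>: "\<pi> \<in> FI_hom {1..deg g} S" and a: "a \<in> Mon S"
    using x by (auto simp: x_eq terms_def)
  let ?q = "snd (gs ! g)"
  have q: "?q \<in> carrier (M {1..deg g})" using g by (rule generator_in)
  have q1: "\<phi> {1..deg g} S \<pi> ?q \<in> carrier (M S)" using map_rules(1)[OF _ S \<pi> q] by simp
  have comp: "\<phi> S T \<epsilon> (\<phi> {1..deg g} S \<pi> ?q) = \<phi> {1..deg g} T (compose {1..deg g} \<epsilon> \<pi>) ?q"
    using map_comp[OF _ S T \<pi> \<epsilon> q] by simp
  have q2: "\<phi> {1..deg g} T (compose {1..deg g} \<epsilon> \<pi>) ?q \<in> carrier (M T)"
    using map_rules(1)[OF S T \<epsilon> q1] comp by simp
  have aS: "single a 1 \<in> B S" using a by (simp add: Mon_def)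
  have "shift \<epsilon> a \<in> Mon T" using Mon_shift[OF S T \<epsilon> a] .
  then have "single (shift \<epsilon> a) 1 \<in> B T" "single \<kappa> 1 \<in> B T" using \<kappa> by (auto simp: Mon_def)
  then show ?thesis
    using map_smult'[OF S T \<epsilon> aS q1] comp q2 module_rules(5)[OF T, of "single \<kappa> 1" "single (shift \<epsilon> a) 1"]
    by (simp add: x_eq vec_def act_def FI_star_single mult_single add.commute)
qed

lemma act_hom_Kspan:
  assumes S: "finite S" and T: "finite T" and \<epsilon>: "\<epsilon> \<in> FI_hom S T" and \<kappa>: "\<kappa> \<in> Mon T"
    and Y: "Y \<subseteq> terms S" and q: "q \<in> Kspan S (vec S ` Y)"
  shows "single \<kappa> 1 \<odot>\<^bsub>M T\<^esub> \<phi> S T \<epsilon> q \<in> Kspan T (vec T ` act \<epsilon> \<kappa> ` Y)"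
proof (rule Kspan_hom[OF S T vec_image_carrier[OF S Y] _ _ _ _ q])
  have \<kappa>B: "single \<kappa> 1 \<in> B T" using \<kappa> by (simp add: Mon_def)
  note m = map_rules[OF S T \<epsilon>]
  show "single \<kappa> 1 \<odot>\<^bsub>M T\<^esub> \<phi> S T \<epsilon> \<zero>\<^bsub>M S\<^esub> = \<zero>\<^bsub>M T\<^esub>"
    using m(3) module_rules(8)[OF T \<kappa>B] by simp
  show "single \<kappa> 1 \<odot>\<^bsub>M T\<^esub> \<phi> S T \<epsilon> (q \<oplus>\<^bsub>M S\<^esub> q')
      = single \<kappa> 1 \<odot>\<^bsub>M T\<^esub> \<phi> S T \<epsilon> q \<oplus>\<^bsub>M T\<^esub> single \<kappa> 1 \<odot>\<^bsub>M T\<^esub> \<phi> S T \<epsilon> q'"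
    if "q \<in> carrier (M S)" "q' \<in> carrier (M S)" for q q'
    using m(1,2) that module_rules(4)[OF T \<kappa>B] by simp
  fix v assume "v \<in> vec S ` Y"
  then obtain y where y: "y \<in> Y" "v = vec S y" by blast
  then have v: "v \<in> carrier (M S)" using vec_carrier[OF S] Y by blast
  show "single \<kappa> 1 \<odot>\<^bsub>M T\<^esub> \<phi> S T \<epsilon> (FI_const k \<odot>\<^bsub>M S\<^esub> v)
      = FI_const k \<odot>\<^bsub>M T\<^esub> (single \<kappa> 1 \<odot>\<^bsub>M T\<^esub> \<phi> S T \<epsilon> v)" for k
    using map_K_linear[OF S T \<epsilon> v] module_rules(5)[OF T] \<kappa>B B(2)[OF T] m(1)[OF v]
    by (simp add: mult.commute)
  show "single \<kappa> 1 \<odot>\<^bsub>M T\<^esub> \<phi> S T \<epsilon> v \<in> vec T ` act \<epsilon> \<kappa> ` Y"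
    using vec_act[OF S T \<epsilon> \<kappa>] y Y by blast
qed

lemma ident_FI_hom: "(\<lambda>x\<in>S. x) \<in> FI_hom S S"
  by (auto simp: FI_hom_def inj_on_def)

lemma zero_in_Mon: "finite S \<Longrightarrow> 0 \<in> Mon S"
  using B(4) by (simp add: Mon_def)

text \<open>
  The spans are closed under the maps \<open>\<phi> S T \<epsilon>\<close> and under multiplication by monomials of \<open>B\<close>, hence by
  all of \<open>B\<close>; so they form a submodule, and it contains the generators as the terms
  \<open>(g, id, 0)\<close>.
\<close>

lemma Kspan_terms_eq_carrier:
  assumes "finite S"
  shows "Kspan S (vec S ` terms S) = carrier (M S)"
proof (rule generators[OF FI_submoduleI _ assms])
  fix S :: "nat set" assume S: "finite S"
  note V = vec_image_carrier[OF S order_refl]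
  show "Kspan S (vec S ` terms S) \<subseteq> carrier (M S)" using Kspan_carrier[OF S V] .
  show "\<zero>\<^bsub>M S\<^esub> \<in> Kspan S (vec S ` terms S)" by (rule Kspan.zero)
  show "q \<oplus>\<^bsub>M S\<^esub> q' \<in> Kspan S (vec S ` terms S)"
    if "q \<in> Kspan S (vec S ` terms S)" "q' \<in> Kspan S (vec S ` terms S)" for q q'
    using Kspan_add[OF S V that] .
  have act_closed: "single \<kappa> 1 \<odot>\<^bsub>M T\<^esub> \<phi> S T \<epsilon> q \<in> Kspan T (vec T ` terms T)"
    if T: "finite T" and \<epsilon>: "\<epsilon> \<in> FI_hom S T" and \<kappa>: "\<kappa> \<in> Mon T" and q: "q \<in> Kspan S (vec S ` terms S)"
    for T \<epsilon> \<kappa> q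
    using act_hom_Kspan[OF S T \<epsilon> \<kappa> order_refl q] act_in_terms[OF S T \<epsilon> \<kappa>]
    by (elim Kspan_mono) blast
  show "\<phi> S T \<epsilon> q \<in> Kspan T (vec T ` terms T)"
    if T: "finite T" and \<epsilon>: "\<epsilon> \<in> FI_hom S T" and q: "q \<in> Kspan S (vec S ` terms S)" for T \<epsilon> q
    using act_closed[OF T \<epsilon> zero_in_Mon[OF T] q] q Kspan_carrier[OF S V]
      module_rules(6)[OF T] map_rules(1)[OF S T \<epsilon>] by auto
  show "p \<odot>\<^bsub>M S\<^esub> q \<in> Kspan S (vec S ` terms S)"
    if p: "p \<in> B S" and q: "q \<in> Kspan S (vec S ` terms S)" for p q
  proof -
    have qc: "q \<in> carrier (M S)" using q Kspan_carrier[OF S V] by blast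
    have mon: "single a 1 \<odot>\<^bsub>M S\<^esub> q \<in> Kspan S (vec S ` terms S)" if "a \<in> Mon S" for a
      using act_closed[OF S ident_FI_hom that q] map_id[OF S qc] by simp
    have "(\<Sum>a\<in>A. single a (lookup p a)) \<in> B S \<and>
          (\<Sum>a\<in>A. single a (lookup p a)) \<odot>\<^bsub>M S\<^esub> q \<in> Kspan S (vec S ` terms S)"
      if "finite A" "A \<subseteq> keys p" for A
      using that
    proof (induction A)
      case empty
      then show ?case using B(3)[OF S] module_rules(7)[OF S qc] by (simp add: Kspan.zero)
    next
      case (insert a A)
      have a: "single a 1 \<in> B S" using monomials_in[OF S p] insert.prems by simp
      have "a \<in> Mon S" using a insert.prems p B(1)[OF S] by (auto simp: Mon_def FI_P_def)
      then have "FI_const (lookup p a) \<odot>\<^bsub>M S\<^esub> (single a 1 \<odot>\<^bsub>M S\<^esub> q) \<in> Kspan S (vec S ` terms S)"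
        using Kspan_const_smult[OF S V] mon by blast
      then have 1: "single a (lookup p a) \<odot>\<^bsub>M S\<^esub> q \<in> Kspan S (vec S ` terms S)"
        using module_rules(5)[OF S B(2)[OF S] a qc] single_eq_const_mult[of a "lookup p a"] by simp
      have 2: "single a (lookup p a) \<in> B S"
        using B(6)[OF S B(2)[OF S] a] single_eq_const_mult[of a "lookup p a"] by simp
      show ?case
        using 1 2 insert B(5)[OF S] module_rules(3)[OF S 2 _ qc] Kspan_add[OF S V] by simp
    qed
    from this[of "keys p"] show ?thesis by (simp add: sum_single_lookup)
  qed
next
  fix n q assume nq: "(n, q) \<in> set gs"
  then obtain g where g: "g < length gs" "gs ! g = (n, q)" by (auto simp: in_set_conv_nth)
  let ?x = "(g, \<lambda>x\<in>{1..n}. x, 0) :: nat \<times> (nat \<Rightarrow> nat) \<times> exps"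
  have "?x \<in> terms {1..n}" using g zero_in_Mon ident_FI_hom by (simp add: terms_def)
  moreover have "vec {1..n} ?x = q"
    using g map_id[of "{1..n}" q] generators_in[OF nq] module_rules(6)[of "{1..n}" q]
    by (simp add: vec_def)
  ultimately show "q \<in> Kspan {1..n} (vec {1..n} ` terms {1..n})"
    using Kspan_base[OF _ vec_image_carrier[OF _ order_refl]] by (metis finite_atLeastAtMost image_eqI)
qed

section \<open>Leading monomials\<close>

definition rank :: "nat \<times> (nat \<Rightarrow> nat) \<times> exps \<Rightarrow> nat \<times> exps" where
  "rank = (\<lambda>(g, \<pi>, a). (g, marked_exps c (deg g) \<pi> a))"

definition lower :: "nat set \<Rightarrow> nat \<times> (nat \<Rightarrow> nat) \<times> exps \<Rightarrow> (nat \<times> (nat \<Rightarrow> nat) \<times> exps) set" where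
  "lower S x = {y \<in> terms S. rank y < rank x}"

text \<open>
  Since the vectors of terms may be linearly dependent, an element can have several leading terms and
  coefficients. The relation \<open>lead\<close> ranges over all choices, and \<open>k = 0\<close> is permitted.
\<close>

definition lead :: "nat set \<Rightarrow> nat \<times> (nat \<Rightarrow> nat) \<times> exps \<Rightarrow> 'k \<Rightarrow> 'm \<Rightarrow> bool" where
  "lead S x k q \<longleftrightarrow> (\<exists>l\<in>Kspan S (vec S ` lower S x). q = FI_const k \<odot>\<^bsub>M S\<^esub> vec S x \<oplus>\<^bsub>M S\<^esub> l)"

lemma lower_subset: "lower S x \<subseteq> terms S"
  by (auto simp: lower_def)

lemma Kspan_lower_carrier: "finite S \<Longrightarrow> Kspan S (vec S ` lower S x) \<subseteq> carrier (M S)"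
  using Kspan_carrier vec_image_carrier lower_subset by metis

lemma keys_rank:
  assumes "x \<in> terms S" "rank x = (g, b)"
  shows "keys b \<subseteq> {1..c + deg g} \<times> S"
  using assms keys_marked_exps[of _ c S _ "deg g"] by (auto simp: rank_def terms_def Mon_def)

text \<open>
  Equal ranks embed into each other by the identity, which therefore intertwines the two injections.
\<close>

lemma rank_inj:
  assumes x: "x \<in> terms S" and y: "y \<in> terms S" and eq: "rank x = rank y"
  shows "x = y"
proof -
  obtain g \<pi> a \<pi>' a' where xy: "x = (g, \<pi>, a)" "y = (g, \<pi>', a')"
    and marked_exps: "marked_exps c (deg g) \<pi> a = marked_exps c (deg g) \<pi>' a'"
    using eq by (cases x; cases y) (auto simp: rank_def)
  have m: "\<pi> \<in> FI_hom {1..deg g} S" "\<pi>' \<in> FI_hom {1..deg g} S"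
    "keys a \<subseteq> {1..c} \<times> S" "keys a' \<subseteq> {1..c} \<times> S"
    using x y by (auto simp: xy terms_def Mon_def)
  have "\<pi>' = compose {1..deg g} (\<lambda>x\<in>S. x) \<pi>"
    by (rule marked_exps_le_imp_divides(1)[OF ident_FI_hom m(1,3,2,4)]) (simp add: marked_exps)
  also have "\<dots> = \<pi>"
  proof
    fix k
    show "compose {1..deg g} (\<lambda>x\<in>S. x) \<pi> k = \<pi> k"
      using m(1) PiE_arb[of \<pi> "{1..deg g}" "\<lambda>_. S" k] by (auto simp: compose_def FI_hom_def)
  qed
  finally show ?thesis using marked_exps by (simp add: xy marked_exps_def)
qed

lemma rank_act_strict_mono:
  assumes x: "x \<in> terms S" and y: "y \<in> terms S" and lt: "rank y < rank x"
    and \<epsilon>: "\<epsilon> \<in> FI_hom S T" "strict_mono_on S \<epsilon>"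
  shows "rank (act \<epsilon> \<kappa> y) < rank (act \<epsilon> \<kappa> x)"
proof -
  obtain g \<pi> a h \<rho> b where xy: "x = (g, \<pi>, a)" "y = (h, \<rho>, b)" by (cases x; cases y)
  have k: "keys (marked_exps c (deg g) \<pi> a) \<subseteq> UNIV \<times> S" "keys (marked_exps c (deg h) \<rho> b) \<subseteq> UNIV \<times> S"
    using keys_rank[OF x] keys_rank[OF y] by (fastforce simp: rank_def xy)+
  consider "h < g" | "h = g" "marked_exps c (deg h) \<rho> b < marked_exps c (deg g) \<pi> a"
    using lt by (auto simp: rank_def xy less_prod_def')
  then show ?thesis
  proof cases
    case 1
    then show ?thesis by (simp add: rank_def act_def xy)
  next
    case 2
    from shift_strict_mono[OF 2(2) \<epsilon>(2) k(2,1)]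
    have "shift \<epsilon> (marked_exps c (deg h) \<rho> b) + \<kappa> < shift \<epsilon> (marked_exps c (deg g) \<pi> a) + \<kappa>"
      by (rule add_strict_right_mono)
    then have "marked_exps c (deg h) (compose {1..deg h} \<epsilon> \<rho>) (shift \<epsilon> b + \<kappa>)
        < marked_exps c (deg g) (compose {1..deg g} \<epsilon> \<pi>) (shift \<epsilon> a + \<kappa>)"
      unfolding marked_exps_compose_shift .
    then show ?thesis using 2(1) unfolding rank_def act_def xy by simp
  qed
qed

text \<open>
  In a linear combination of vectors of terms, collect the summands with the largest term.
\<close>

lemma lead_exists:
  assumes S: "finite S" and Y: "Y \<subseteq> terms S" and q: "q \<in> Kspan S (vec S ` Y)"
  shows "q = \<zero>\<^bsub>M S\<^esub> \<or> (\<exists>y\<in>Y. \<exists>k. lead S y k q)"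
proof -
  interpret abelian_group "M S" using module_rules(1)[OF S] .
  have vc: "vec S y \<in> carrier (M S)" if "y \<in> terms S" for y using vec_carrier[OF S that] .
  have kc: "FI_const k \<odot>\<^bsub>M S\<^esub> vec S y \<in> carrier (M S)" if "y \<in> terms S" for y k
    using module_rules(2)[OF S B(2)[OF S] vc[OF that]] .
  from q show ?thesis
  proof (induction rule: Kspan.induct)
    case zero
    then show ?case by simp
  next
    case (add v q k)
    then obtain y where y: "y \<in> Y" "v = vec S y" by blast
    then have y_in: "y \<in> terms S" using Y by blast
    from add.IH show ?case
    proof (elim disjE bexE exE)
      assume "q = \<zero>\<^bsub>M S\<^esub>"
      then have "lead S y k (FI_const k \<odot>\<^bsub>M S\<^esub> v \<oplus>\<^bsub>M S\<^esub> q)"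
        using y(2) by (auto simp: lead_def intro: Kspan.zero)
      then show ?thesis using y(1) by blast
    next
      fix x k' assume x: "x \<in> Y" and "lead S x k' q"
      then obtain l where l: "l \<in> Kspan S (vec S ` lower S x)"
        and q: "q = FI_const k' \<odot>\<^bsub>M S\<^esub> vec S x \<oplus>\<^bsub>M S\<^esub> l" by (auto simp: lead_def)
      have x_in: "x \<in> terms S" using x Y by blast
      have lc: "l \<in> carrier (M S)" using l Kspan_lower_carrier[OF S] by blast
      consider "rank y < rank x" | "rank x < rank y" | "y = x"
        using rank_inj[OF y_in x_in] by (meson linorder_less_linear)
      then show ?thesis
      proof cases
        case 1
        then have "FI_const k \<odot>\<^bsub>M S\<^esub> vec S y \<oplus>\<^bsub>M S\<^esub> l \<in> Kspan S (vec S ` lower S x)"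
          using y_in l by (intro Kspan.add) (auto simp: lower_def)
        moreover have "FI_const k \<odot>\<^bsub>M S\<^esub> v \<oplus>\<^bsub>M S\<^esub> q
            = FI_const k' \<odot>\<^bsub>M S\<^esub> vec S x \<oplus>\<^bsub>M S\<^esub> (FI_const k \<odot>\<^bsub>M S\<^esub> vec S y \<oplus>\<^bsub>M S\<^esub> l)"
          using kc[OF x_in] kc[OF y_in] lc by (simp add: q y(2) a_lcomm)
        ultimately show ?thesis using x by (auto simp: lead_def)
      next
        case 2
        then have "lower S x \<subseteq> lower S y" "x \<in> lower S y" using x_in by (auto simp: lower_def)
        then have "q \<in> Kspan S (vec S ` lower S y)"
          unfolding q using l by (intro Kspan.add) (auto intro: Kspan_mono)
        then show ?thesis using y by (auto simp: lead_def)
      next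
        case 3
        have "FI_const k \<odot>\<^bsub>M S\<^esub> v \<oplus>\<^bsub>M S\<^esub> q
            = FI_const (k + k') \<odot>\<^bsub>M S\<^esub> vec S x \<oplus>\<^bsub>M S\<^esub> l"
          using kc[OF x_in] lc module_rules(3)[OF S B(2)[OF S] B(2)[OF S] vc[OF x_in], of k k']
          by (simp add: q y(2) 3 a_assoc FI_const_def single_add)
        then show ?thesis using l x by (auto simp: lead_def)
      qed
    qed
  qed
qed

text \<open>
  Terms below \<open>x\<close> are carried to terms below the image of \<open>x\<close>, so the operation keeps the leading
  coefficient.
\<close>

lemma lead_act:
  assumes S: "finite S" and T: "finite T" and \<epsilon>: "\<epsilon> \<in> FI_hom S T" "strict_mono_on S \<epsilon>"
    and \<kappa>: "\<kappa> \<in> Mon T" and x: "x \<in> terms S" and lead: "lead S x k q"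
  shows "lead T (act \<epsilon> \<kappa> x) k (single \<kappa> 1 \<odot>\<^bsub>M T\<^esub> \<phi> S T \<epsilon> q)"
proof -
  obtain l where l: "l \<in> Kspan S (vec S ` lower S x)"
    and q: "q = FI_const k \<odot>\<^bsub>M S\<^esub> vec S x \<oplus>\<^bsub>M S\<^esub> l" using lead by (auto simp: lead_def)
  note m = map_rules[OF S T \<epsilon>(1)]
  have v: "vec S x \<in> carrier (M S)" using vec_carrier[OF S x] .
  have kv: "FI_const k \<odot>\<^bsub>M S\<^esub> vec S x \<in> carrier (M S)" using module_rules(2)[OF S B(2)[OF S] v] .
  have lc: "l \<in> carrier (M S)" using l Kspan_lower_carrier[OF S] by blast
  have \<kappa>B: "single \<kappa> 1 \<in> B T" using \<kappa> by (simp add: Mon_def)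
  have "single \<kappa> 1 \<odot>\<^bsub>M T\<^esub> \<phi> S T \<epsilon> (FI_const k \<odot>\<^bsub>M S\<^esub> vec S x)
      = FI_const k \<odot>\<^bsub>M T\<^esub> vec T (act \<epsilon> \<kappa> x)"
    using map_K_linear[OF S T \<epsilon>(1) v] vec_act[OF S T \<epsilon>(1) \<kappa> x] module_rules(5)[OF T] \<kappa>B
      B(2)[OF T] m(1)[OF v] by (metis mult.commute)
  then have "single \<kappa> 1 \<odot>\<^bsub>M T\<^esub> \<phi> S T \<epsilon> q
      = FI_const k \<odot>\<^bsub>M T\<^esub> vec T (act \<epsilon> \<kappa> x) \<oplus>\<^bsub>M T\<^esub> single \<kappa> 1 \<odot>\<^bsub>M T\<^esub> \<phi> S T \<epsilon> l"
    using m(1,2) kv lc module_rules(4)[OF T \<kappa>B] by (simp add: q)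
  moreover have sub: "act \<epsilon> \<kappa> ` lower S x \<subseteq> lower T (act \<epsilon> \<kappa> x)"
    using act_in_terms[OF S T \<epsilon>(1) \<kappa>] rank_act_strict_mono[OF x _ _ \<epsilon>] by (auto simp: lower_def)
  have "single \<kappa> 1 \<odot>\<^bsub>M T\<^esub> \<phi> S T \<epsilon> l \<in> Kspan T (vec T ` lower T (act \<epsilon> \<kappa> x))"
    by (rule Kspan_mono[OF act_hom_Kspan[OF S T \<epsilon>(1) \<kappa> lower_subset l] image_mono[OF sub]])
  ultimately show ?thesis by (auto simp: lead_def)
qed

lemma lead_coefficient_ideal:
  assumes N: "FI_submodule B M \<phi> N" and S: "finite S" and x: "x \<in> terms S"
  shows "ideal {k. \<exists>p\<in>N S. lead S x k p} (ring_on (UNIV :: 'k set))" (is "ideal ?I _")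
proof -
  interpret K: cring "ring_on (UNIV :: 'k set)" by (rule cring_ring_on) auto
  interpret abelian_group "M S" using module_rules(1)[OF S] .
  note ND = FI_submoduleD[OF N S]
  have V: "vec S ` lower S x \<subseteq> carrier (M S)" using vec_image_carrier[OF S lower_subset] .
  have v: "vec S x \<in> carrier (M S)" using vec_carrier[OF S x] .
  have kv: "FI_const k \<odot>\<^bsub>M S\<^esub> vec S x \<in> carrier (M S)" for k
    using module_rules(2)[OF S B(2)[OF S] v] .
  have zero: "0 \<in> ?I"
  proof -
    have "lead S x 0 \<zero>\<^bsub>M S\<^esub>"
      unfolding lead_def using module_rules(7)[OF S v]
      by (intro bexI[OF _ Kspan.zero]) (simp add: FI_const_def)
    then show ?thesis using ND(2) by blast
  qed
  have add: "k + k' \<in> ?I" if k: "k \<in> ?I" and k': "k' \<in> ?I" for k k'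
  proof -
    obtain p l where p: "p \<in> N S" "l \<in> Kspan S (vec S ` lower S x)"
      "p = FI_const k \<odot>\<^bsub>M S\<^esub> vec S x \<oplus>\<^bsub>M S\<^esub> l" using k by (auto simp: lead_def)
    obtain p' l' where p': "p' \<in> N S" "l' \<in> Kspan S (vec S ` lower S x)"
      "p' = FI_const k' \<odot>\<^bsub>M S\<^esub> vec S x \<oplus>\<^bsub>M S\<^esub> l'" using k' by (auto simp: lead_def)
    have lc: "l \<in> carrier (M S)" "l' \<in> carrier (M S)"
      using p(2) p'(2) Kspan_lower_carrier[OF S, of x] by blast+
    have "FI_const (k + k') = (FI_const k + FI_const k' :: 'k FI_poly)"
      by (simp add: FI_const_def single_add)
    then have "p \<oplus>\<^bsub>M S\<^esub> p' = FI_const (k + k') \<odot>\<^bsub>M S\<^esub> vec S x \<oplus>\<^bsub>M S\<^esub> (l \<oplus>\<^bsub>M S\<^esub> l')"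
      using p(3) p'(3) lc kv module_rules(3)[OF S B(2)[OF S] B(2)[OF S] v, of k k']
      by (simp add: a_ac)
    then have "lead S x (k + k') (p \<oplus>\<^bsub>M S\<^esub> p')"
      unfolding lead_def using Kspan_add[OF S V p(2) p'(2)] by blast
    then show ?thesis using ND(3)[OF p(1) p'(1)] by blast
  qed
  have mult: "r * k \<in> ?I" if k: "k \<in> ?I" for r k
  proof -
    obtain p l where p: "p \<in> N S" "l \<in> Kspan S (vec S ` lower S x)"
      "p = FI_const k \<odot>\<^bsub>M S\<^esub> vec S x \<oplus>\<^bsub>M S\<^esub> l" using k by (auto simp: lead_def)
    have lc: "l \<in> carrier (M S)" using p(2) Kspan_lower_carrier[OF S, of x] by blast
    have "FI_const (r * k) = (FI_const r * FI_const k :: 'k FI_poly)"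
      by (simp add: FI_const_def mult_single)
    then have "FI_const r \<odot>\<^bsub>M S\<^esub> p
        = FI_const (r * k) \<odot>\<^bsub>M S\<^esub> vec S x \<oplus>\<^bsub>M S\<^esub> FI_const r \<odot>\<^bsub>M S\<^esub> l"
      using p(3) lc kv v module_rules(4,5)[OF S] B(2)[OF S] by simp
    then have "lead S x (r * k) (FI_const r \<odot>\<^bsub>M S\<^esub> p)"
      unfolding lead_def using Kspan_const_smult[OF S V p(2)] by blast
    then show ?thesis using ND(4)[OF B(2)[OF S] p(1)] by blast
  qed
  have neg: "\<ominus>\<^bsub>ring_on (UNIV :: 'k set)\<^esub> k = - k" for k :: 'k
    by (rule K.minus_equality) auto
  show ?thesis
  proof (rule idealI)
    show "ring (ring_on (UNIV :: 'k set))" ..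
    show "subgroup ?I (add_monoid (ring_on (UNIV :: 'k set)))"
    proof (rule K.add.subgroupI)
      show "?I \<noteq> {}" using zero by blast
      show "\<ominus>\<^bsub>ring_on (UNIV :: 'k set)\<^esub> k \<in> ?I" if "k \<in> ?I" for k
        using mult[OF that, of "- 1"] by (simp add: neg)
      show "k \<oplus>\<^bsub>ring_on (UNIV :: 'k set)\<^esub> k' \<in> ?I" if "k \<in> ?I" "k' \<in> ?I" for k k'
        using add[OF that] by simp
    qed simp
    show "r \<otimes>\<^bsub>ring_on (UNIV :: 'k set)\<^esub> k \<in> ?I" if "k \<in> ?I" for r k using mult[OF that] by simp
    show "k \<otimes>\<^bsub>ring_on (UNIV :: 'k set)\<^esub> r \<in> ?I" if "k \<in> ?I" for r k
      using mult[OF that, of r] by (simp add: mult.commute)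
  qed
qed

lemma lead_diff:
  assumes S: "finite S" and x: "x \<in> terms S" and q: "lead S x k q" and p: "lead S x k p"
  shows "q \<ominus>\<^bsub>M S\<^esub> p \<in> Kspan S (vec S ` lower S x)"
proof -
  interpret abelian_group "M S" using module_rules(1)[OF S] .
  have V: "vec S ` lower S x \<subseteq> carrier (M S)" using vec_image_carrier[OF S lower_subset] .
  obtain l l' where l: "l \<in> Kspan S (vec S ` lower S x)" "l' \<in> Kspan S (vec S ` lower S x)"
    and q: "q = FI_const k \<odot>\<^bsub>M S\<^esub> vec S x \<oplus>\<^bsub>M S\<^esub> l"
    and p: "p = FI_const k \<odot>\<^bsub>M S\<^esub> vec S x \<oplus>\<^bsub>M S\<^esub> l'" using q p by (auto simp: lead_def)
  have lc: "l \<in> carrier (M S)" "l' \<in> carrier (M S)" using l Kspan_lower_carrier[OF S, of x] by blast+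
  have u: "FI_const k \<odot>\<^bsub>M S\<^esub> vec S x \<in> carrier (M S)"
    using module_rules(2)[OF S B(2)[OF S] vec_carrier[OF S x]] .
  have "q \<ominus>\<^bsub>M S\<^esub> p = l \<oplus>\<^bsub>M S\<^esub> \<ominus>\<^bsub>M S\<^esub> l'"
    using u lc unfolding q p minus_eq by (simp add: minus_add a_ac r_neg r_neg2 r_neg1)
  also have "\<dots> = l \<oplus>\<^bsub>M S\<^esub> FI_const (- 1) \<odot>\<^bsub>M S\<^esub> l'"
    using module_rules(9)[OF S lc(2)] by simp
  finally show ?thesis using Kspan_add[OF S V l(1) Kspan_const_smult[OF S V l(2)]] by simp
qed

section \<open>Submodules generated by a set\<close>

definition fgen :: "(nat \<times> 'm) set \<Rightarrow> nat set \<Rightarrow> 'm set" where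
  "fgen G S = \<Inter> {N S | N. FI_submodule B M \<phi> N \<and> (\<forall>(n, q)\<in>G. q \<in> N {1..n})}"

lemma fgen_least:
  assumes "FI_submodule B M \<phi> N" "\<And>n q. (n, q) \<in> G \<Longrightarrow> q \<in> N {1..n}"
  shows "fgen G S \<subseteq> N S"
  using assms unfolding fgen_def by blast

lemma fgen_superset: "(n, q) \<in> G \<Longrightarrow> q \<in> fgen G {1..n}"
  unfolding fgen_def by blast

lemma carrier_FI_submodule: "FI_submodule B M \<phi> (\<lambda>S. carrier (M S))"
proof (rule FI_submoduleI)
  fix S :: "nat set" assume S: "finite S"
  interpret abelian_group "M S" using module_rules(1)[OF S] .
  show "\<zero>\<^bsub>M S\<^esub> \<in> carrier (M S)" by simp
  show "q \<oplus>\<^bsub>M S\<^esub> q' \<in> carrier (M S)" if "q \<in> carrier (M S)" "q' \<in> carrier (M S)" for q q'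
    using that by simp
qed (auto intro: module_rules(2) map_rules(1))

lemma fgen_FI_submodule:
  assumes "G \<subseteq> (SIGMA n:UNIV. carrier (M {1..n}))"
  shows "FI_submodule B M \<phi> (fgen G)"
proof (rule FI_submoduleI)
  fix S :: "nat set" assume S: "finite S"
  show "fgen G S \<subseteq> carrier (M S)"
    using assms by (intro fgen_least carrier_FI_submodule) auto
  show "\<zero>\<^bsub>M S\<^esub> \<in> fgen G S" unfolding fgen_def using FI_submoduleD(2)[OF _ S] by blast
  show "q \<oplus>\<^bsub>M S\<^esub> q' \<in> fgen G S" if "q \<in> fgen G S" "q' \<in> fgen G S" for q q'
    using that FI_submoduleD(3)[OF _ S] unfolding fgen_def by blast
  show "p \<odot>\<^bsub>M S\<^esub> q \<in> fgen G S" if "p \<in> B S" "q \<in> fgen G S" for p q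
    using that FI_submoduleD(4)[OF _ S] unfolding fgen_def by blast
  show "\<phi> S T \<epsilon> q \<in> fgen G T" if "finite T" "\<epsilon> \<in> FI_hom S T" "q \<in> fgen G S" for T \<epsilon> q
    unfolding fgen_def
  proof (intro InterI, clarify)
    fix N assume N: "FI_submodule B M \<phi> N" "\<forall>(n, q)\<in>G. q \<in> N {1..n}"
    then have "q \<in> N S" using that(3) unfolding fgen_def by blast
    then show "\<phi> S T \<epsilon> q \<in> N T" by (rule FI_submoduleD(6)[OF N(1) S that(1,2)])
  qed
qed

text \<open>
  Every finite set is in bijection with some \<open>{1..n}\<close>, so a submodule is determined by its
  values there.
\<close>

lemma FI_submodule_le_on_finite:
  assumes N: "FI_submodule B M \<phi> N" and N': "FI_submodule B M \<phi> N'"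
    and le: "\<And>n. N {1..n} \<subseteq> N' {1..n}" and S: "finite S"
  shows "N S \<subseteq> N' S"
proof
  fix q assume q: "q \<in> N S"
  then have qc: "q \<in> carrier (M S)" using FI_submoduleD(1)[OF N S] by blast
  let ?n = "{1..card S}"
  obtain h where h: "bij_betw h ?n S" using ex_bij_betw_nat_finite_1[OF S] by blast
  define \<epsilon> where "\<epsilon> = (\<lambda>i\<in>?n. h i)"
  define \<delta> where "\<delta> = (\<lambda>s\<in>S. inv_into ?n h s)"
  have \<epsilon>: "\<epsilon> \<in> FI_hom ?n S"
    unfolding \<epsilon>_def FI_hom_def
    using bij_betwE[OF h] bij_betw_imp_inj_on[OF h] by (simp add: inj_on_restrict_eq)
  have inv: "bij_betw (inv_into ?n h) S ?n" using h by (rule bij_betw_inv_into)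
  have \<delta>: "\<delta> \<in> FI_hom S ?n"
    unfolding \<delta>_def FI_hom_def
    using bij_betwE[OF inv] bij_betw_imp_inj_on[OF inv] by (simp add: inj_on_restrict_eq)
  have "compose S \<epsilon> \<delta> = (\<lambda>x\<in>S. x)"
  proof
    fix s
    show "compose S \<epsilon> \<delta> s = (\<lambda>x\<in>S. x) s"
    proof (cases "s \<in> S")
      case True
      then have "inv_into ?n h s \<in> ?n" "h (inv_into ?n h s) = s"
        using bij_betwE[OF inv] bij_betw_inv_into_right[OF h] by blast+
      then show ?thesis using True by (simp add: compose_def \<epsilon>_def \<delta>_def)
    qed (simp add: compose_def)
  qed
  then have "q = \<phi> ?n S \<epsilon> (\<phi> S ?n \<delta> q)"
    using map_comp[OF S _ S \<delta> \<epsilon> qc] map_id[OF S qc] by simp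
  moreover have "\<phi> S ?n \<delta> q \<in> N' ?n" using FI_submoduleD(6)[OF N S _ \<delta> q] le by blast
  ultimately show "q \<in> N' S" using FI_submoduleD(6)[OF N' _ S \<epsilon>] by (metis finite_atLeastAtMost)
qed

text \<open>
  A submodule of \<open>N\<close>, regarded as a module, is a submodule of \<open>M\<close>, so that generation within \<open>N\<close> can
  be tested by submodules of \<open>M\<close>.
\<close>

lemma FI_finitely_generatedI:
  assumes N: "FI_submodule B M \<phi> N" and G: "finite G" "G \<subseteq> (SIGMA n:UNIV. N {1..n})"
    and gen: "\<And>n. N {1..n} \<subseteq> fgen G {1..n}"
  shows "FI_finitely_generated B (\<lambda>S. (M S)\<lparr>carrier := N S\<rparr>) \<phi>"
  unfolding FI_finitely_generated_def
proof (intro exI[of _ G] conjI allI impI)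
  show "finite G" "G \<subseteq> (SIGMA n:UNIV. carrier ((M {1..n})\<lparr>carrier := N {1..n}\<rparr>))" using G by auto
  have "G \<subseteq> (SIGMA n:UNIV. carrier (M {1..n}))" using G(2) FI_submoduleD(1)[OF N] by fastforce
  note fg = fgen_FI_submodule[OF this]
  fix N' S
  assume N': "FI_submodule B (\<lambda>S. (M S)\<lparr>carrier := N S\<rparr>) \<phi> N'"
    and GN': "\<forall>(n, q)\<in>G. q \<in> N' {1..n}" and S: "finite (S :: nat set)"
  have sub: "submodule (N' T) (ring_on (B T)) ((M T)\<lparr>carrier := N T\<rparr>)" if "finite T" for T
    using N' that by (simp add: FI_submodule_def)
  have N'_sub: "N' T \<subseteq> N T" if "finite T" for T
    using subgroup.subset[OF submodule.axioms(1)[OF sub[OF that]]] by simp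
  have "FI_submodule B M \<phi> N'"
  proof (rule FI_submoduleI)
    fix T :: "nat set" assume T: "finite T"
    note sg = submodule.axioms(1)[OF sub[OF T]]
    show "N' T \<subseteq> carrier (M T)" using N'_sub[OF T] FI_submoduleD(1)[OF N T] by blast
    show "\<zero>\<^bsub>M T\<^esub> \<in> N' T" using subgroup.one_closed[OF sg] by simp
    show "q \<oplus>\<^bsub>M T\<^esub> q' \<in> N' T" if "q \<in> N' T" "q' \<in> N' T" for q q'
      using subgroup.m_closed[OF sg that] by simp
    show "p \<odot>\<^bsub>M T\<^esub> q \<in> N' T" if "p \<in> B T" "q \<in> N' T" for p q
      using submodule.smult_closed[OF sub[OF T], of p q] that by simp
    show "\<phi> T U \<epsilon> q \<in> N' U" if "finite U" "\<epsilon> \<in> FI_hom T U" "q \<in> N' T" for U \<epsilon> q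
    proof -
      have "\<phi> T U \<epsilon> ` N' T \<subseteq> N' U" using N' T that by (simp add: FI_submodule_def)
      then show ?thesis using that(3) by (rule subsetD[OF _ imageI])
    qed
  qed
  then have "fgen G S \<subseteq> N' S" using GN' by (intro fgen_least) auto
  moreover have "N S \<subseteq> fgen G S" using FI_submodule_le_on_finite[OF N fg gen S] .
  ultimately show "N' S = carrier ((M S)\<lparr>carrier := N S\<rparr>)" using N'_sub[OF S] by auto
qed

section \<open>The noetherian property\<close>

text \<open>
  The element \<open>q\<close> of \<open>N\<close> escapes the submodule generated by \<open>G\<close> and has a leading term \<open>x\<close> that is
  minimal for this; elements are compared only with elements of the same \<open>N {1..n}\<close>.
\<close>

definition least_lead :: "(nat set \<Rightarrow> 'm set) \<Rightarrow> (nat \<times> 'm) set \<Rightarrow>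
    nat \<times> 'm \<times> (nat \<times> (nat \<Rightarrow> nat) \<times> exps) \<times> 'k \<Rightarrow> bool" where
  "least_lead N G = (\<lambda>(n, q, x, k). q \<in> N {1..n} \<and> q \<notin> fgen G {1..n} \<and> x \<in> terms {1..n} \<and>
     lead {1..n} x k q \<and>
     (\<forall>y\<in>lower {1..n} x. \<forall>k' q'. q' \<in> N {1..n} \<longrightarrow> lead {1..n} y k' q' \<longrightarrow> q' \<in> fgen G {1..n}))"

lemma least_lead_exists:
  assumes N: "FI_submodule B M \<phi> N" and G: "G \<subseteq> (SIGMA n:UNIV. N {1..n})"
    and q: "q \<in> N {1..n}" "q \<notin> fgen G {1..n}"
  shows "\<exists>e. least_lead N G e"
proof -
  let ?S = "{1..n}"
  have "G \<subseteq> (SIGMA n:UNIV. carrier (M {1..n}))" using G FI_submoduleD(1)[OF N] by fastforce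
  note fg = fgen_FI_submodule[OF this]
  define A where "A = {rank x | x. x \<in> terms ?S \<and> (\<exists>k q. q \<in> N ?S \<and> q \<notin> fgen G ?S \<and> lead ?S x k q)}"
  have "q \<in> Kspan ?S (vec ?S ` terms ?S)"
    using Kspan_terms_eq_carrier[of ?S] q(1) FI_submoduleD(1)[OF N, of ?S] by auto
  moreover have "q \<noteq> \<zero>\<^bsub>M ?S\<^esub>" using q(2) FI_submoduleD(2)[OF fg, of ?S] by auto
  ultimately obtain x k where "x \<in> terms ?S" "lead ?S x k q"
    using lead_exists[of ?S "terms ?S" q] by auto
  then have ne: "A \<noteq> {}" using q unfolding A_def by blast
  \<comment> \<open>A bound for all degrees, so that one finite set of variables supports every rank.\<close>
  define D where "D = (\<Sum>g<length gs. deg g)"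
  have deg: "deg g \<le> D" if "g < length gs" for g
    unfolding D_def using that by (intro member_le_sum) auto
  have "keys b \<subseteq> {1..c + D} \<times> ?S" if "(g, b) \<in> A" for g b
  proof -
    obtain x where x: "x \<in> terms ?S" "rank x = (g, b)" using \<open>(g, b) \<in> A\<close> unfolding A_def by force
    then have "g < length gs" by (auto simp: terms_def rank_def)
    then have "{1..c + deg g} \<subseteq> {1..c + D}" using deg by fastforce
    then show ?thesis using keys_rank[OF x] by blast
  qed
  then have supp: "A \<subseteq> UNIV \<times> {b. keys b \<subseteq> {1..c + D} \<times> ?S}" by auto
  have fin: "finite ({1..c + D} \<times> ?S)" by simp
  obtain m where m: "m \<in> A" "\<And>r. r \<in> A \<Longrightarrow> m \<le> r"
    using finite_support_exps_least[OF fin supp ne] by blast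
  then obtain x k p where x: "m = rank x" "x \<in> terms ?S" "p \<in> N ?S" "p \<notin> fgen G ?S" "lead ?S x k p"
    unfolding A_def by auto
  have "q' \<in> fgen G ?S" if "y \<in> lower ?S x" "q' \<in> N ?S" "lead ?S y k' q'" for y k' q'
  proof (rule ccontr)
    assume "q' \<notin> fgen G ?S"
    then have "rank y \<in> A" using that unfolding A_def lower_def by blast
    then show False using m(2) that(1) x(1) by (fastforce simp: lower_def)
  qed
  then have "least_lead N G (n, p, x, k)" using x by (auto simp: least_lead_def)
  then show ?thesis by blast
qed

end

text \<open>
  The divisibility hypothesis, in terms of exponent vectors.
\<close>

locale divisor_closed_FI_module = monomial_FI_module B M \<phi> c gs
  for B :: "nat set \<Rightarrow> 'k::comm_ring_1 FI_poly set"
    and M :: "nat set \<Rightarrow> ('k FI_poly, 'm) module" and \<phi> and c and gs +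
  assumes divisor_in: "\<lbrakk>\<epsilon> \<in> FI_hom {1..m} {1..n}; single a 1 \<in> B {1..m};
      single (shift \<epsilon> a + \<kappa>) 1 \<in> B {1..n}; keys \<kappa> \<subseteq> {1..c} \<times> {1..n}\<rbrakk> \<Longrightarrow> single \<kappa> 1 \<in> B {1..n}"
begin

text \<open>
  First pass to terms with a common generator, then to a chain of column embeddings of their
  marked exponent vectors.
\<close>

lemma terms_chain:
  assumes x: "\<And>i. x i \<in> terms {1..n i}"
  obtains s :: "nat \<Rightarrow> nat" where "strict_mono s"
    and "\<And>i j. i < j \<Longrightarrow> \<exists>\<epsilon>\<in>FI_hom {1..n (s i)} {1..n (s j)}. \<exists>\<kappa>\<in>Mon {1..n (s j)}.
           strict_mono_on {1..n (s i)} \<epsilon> \<and> x (s j) = act \<epsilon> \<kappa> (x (s i))"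
proof -
  define gen where "gen i = fst (x i)" for i
  have "gen i < length gs" for i using x[of i] by (cases "x i") (simp add: gen_def terms_def)
  then have "gen ` UNIV \<subseteq> {..<length gs}" by auto
  then have "finite (gen ` UNIV)" by (rule finite_subset) simp
  then obtain i0 where inf: "infinite {i. gen i = gen i0}"
    using pigeonhole_infinite[of "UNIV :: nat set" gen] by auto
  define g where "g = gen i0"
  define t where "t = enumerate {i. gen i = g}"
  have t: "strict_mono t" unfolding t_def using inf by (intro strict_mono_enumerate) (simp add: g_def)
  have tg: "gen (t i) = g" for i
    using enumerate_in_set[of "{i. gen i = g}" i] inf by (simp add: t_def g_def)
  define \<pi> a where "\<pi> i = fst (snd (x (t i)))" and "a i = snd (snd (x (t i)))" for i
  have xt: "x (t i) = (g, \<pi> i, a i)" for i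
    using tg[of i] by (simp add: gen_def \<pi>_def a_def prod_eq_iff)
  have \<pi>: "\<pi> i \<in> FI_hom {1..deg g} {1..n (t i)}" and a: "a i \<in> Mon {1..n (t i)}" for i
    using x[of "t i"] by (simp_all add: xt terms_def)
  have ak: "keys (a i) \<subseteq> {1..c} \<times> {1..n (t i)}" for i using a[of i] by (simp add: Mon_def)
  obtain u :: "nat \<Rightarrow> nat" where u: "strict_mono u"
    and emb: "\<And>i j. i < j \<Longrightarrow> \<exists>\<epsilon>\<in>FI_hom {1..n (t (u i))} {1..n (t (u j))}.
         strict_mono_on {1..n (t (u i))} \<epsilon> \<and>
         (\<forall>r\<in>{1..c + deg g}. \<forall>k\<in>{1..n (t (u i))}.
            lookup (marked_exps c (deg g) (\<pi> (u i)) (a (u i))) (r, k)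
          \<le> lookup (marked_exps c (deg g) (\<pi> (u j)) (a (u j))) (r, \<epsilon> k))"
    using exps_column_embedding_chain[where n = "\<lambda>i. n (t i)"
          and b = "\<lambda>i. marked_exps c (deg g) (\<pi> i) (a i)" and C = "c + deg g"] by blast
  show thesis
  proof (rule that[of "\<lambda>i. t (u i)"])
    show "strict_mono (\<lambda>i. t (u i))" using t u by (simp add: strict_mono_def)
    fix i j :: nat assume "i < j"
    from emb[OF this] obtain \<epsilon> where \<epsilon>: "\<epsilon> \<in> FI_hom {1..n (t (u i))} {1..n (t (u j))}"
      "strict_mono_on {1..n (t (u i))} \<epsilon>"
      and le: "\<And>r k. \<lbrakk>r \<in> {1..c + deg g}; k \<in> {1..n (t (u i))}\<rbrakk> \<Longrightarrow>
            lookup (marked_exps c (deg g) (\<pi> (u i)) (a (u i))) (r, k)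
          \<le> lookup (marked_exps c (deg g) (\<pi> (u j)) (a (u j))) (r, \<epsilon> k)" by blast
    define \<kappa> where "\<kappa> = a (u j) - shift \<epsilon> (a (u i))"
    note d = marked_exps_le_imp_divides[OF \<epsilon>(1) \<pi> ak \<pi> ak le, folded \<kappa>_def]
    have "\<kappa> \<in> Mon {1..n (t (u j))}"
      using divisor_in[OF \<epsilon>(1) _ _ d(3), of "a (u i)"] d(2,3) a[of "u i"] a[of "u j"]
      by (simp add: Mon_def)
    moreover have "x (t (u j)) = act \<epsilon> \<kappa> (x (t (u i)))"
      using d(1,2) by (simp add: xt act_def)
    ultimately show "\<exists>\<epsilon>\<in>FI_hom {1..n (t (u i))} {1..n (t (u j))}. \<exists>\<kappa>\<in>Mon {1..n (t (u j))}.
           strict_mono_on {1..n (t (u i))} \<epsilon> \<and> x (t (u j)) = act \<epsilon> \<kappa> (x (t (u i)))"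
      using \<epsilon> by blast
  qed
qed

text \<open>
  The contradiction is reached at an index \<open>m\<close> of the chain at which the leading coefficient lies in
  the ideal of the earlier ones. The scalars that occur as coefficients at the term \<open>x (s m)\<close> of elements
  generated by the predecessors form an ideal, so no linear combination has to be written down.
\<close>

theorem noetherian:
  assumes K: "noetherian_ring (ring_on (UNIV :: 'k set))"
  shows "FI_noetherian B M \<phi>"
  unfolding FI_noetherian_def
proof (intro allI impI)
  fix N assume N: "FI_submodule B M \<phi> N"
  show "FI_finitely_generated B (\<lambda>S. (M S)\<lparr>carrier := N S\<rparr>) \<phi>"
  proof (rule ccontr)
    assume notfg: "\<not> ?thesis"
    have escape: "\<exists>e. least_lead N G e"
      if G: "finite G" "G \<subseteq> (SIGMA n:UNIV. N {1..n})" for G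
      using FI_finitely_generatedI[OF N G] notfg least_lead_exists[OF N G(2)] by blast
    \<comment> \<open>The greedy sequence: \<open>H i\<close> holds the elements chosen before stage \<open>i\<close>.\<close>
    define pick where "pick G = (SOME e. least_lead N G e)" for G
    define H where "H = rec_nat {} (\<lambda>_ G. insert (fst (pick G), fst (snd (pick G))) G)"
    define n where "n i = fst (pick (H i))" for i
    define q where "q i = fst (snd (pick (H i)))" for i
    define x where "x i = fst (snd (snd (pick (H i))))" for i
    define k where "k i = snd (snd (snd (pick (H i))))" for i
    have H0: "H 0 = {}" and HS: "H (Suc i) = insert (n i, q i) (H i)" for i
      by (simp_all add: H_def n_def q_def)
    have H: "finite (H i) \<and> H i \<subseteq> (SIGMA n:UNIV. N {1..n})" for i
    proof (induction i)
      case (Suc i)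
      then have "least_lead N (H i) (pick (H i))"
        unfolding pick_def using escape[of "H i"] by (blast intro: someI_ex)
      then have "q i \<in> N {1..n i}" by (simp add: least_lead_def n_def q_def case_prod_beta)
      then show ?case using Suc by (simp add: HS)
    qed (simp add: H0)
    have "least_lead N (H i) (pick (H i))" for i
      unfolding pick_def using escape[of "H i"] H[of i] by (blast intro: someI_ex)
    then have ll: "least_lead N (H i) (n i, q i, x i, k i)" for i
      by (simp add: n_def q_def x_def k_def)
    have qN: "q i \<in> N {1..n i}" and q_out: "q i \<notin> fgen (H i) {1..n i}"
      and x: "x i \<in> terms {1..n i}" and lead: "lead {1..n i} (x i) (k i) (q i)"
      and least: "\<And>y k' q'. \<lbrakk>y \<in> lower {1..n i} (x i); q' \<in> N {1..n i}; lead {1..n i} y k' q'\<rbrakk>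
                    \<Longrightarrow> q' \<in> fgen (H i) {1..n i}" for i
      using ll[of i] by (auto simp: least_lead_def)
    have in_H: "(n i, q i) \<in> H j" if "i < j" for i j
      using that by (induction j) (auto simp: HS less_Suc_eq)
    obtain s :: "nat \<Rightarrow> nat" where s: "strict_mono s"
      and chain: "\<And>i j. i < j \<Longrightarrow> \<exists>\<epsilon>\<in>FI_hom {1..n (s i)} {1..n (s j)}. \<exists>\<kappa>\<in>Mon {1..n (s j)}.
           strict_mono_on {1..n (s i)} \<epsilon> \<and> x (s j) = act \<epsilon> \<kappa> (x (s i))"
      using terms_chain[of x n, OF x] by blast
    obtain m where m: "k (s m) \<in> genideal (ring_on UNIV) ((\<lambda>i. k (s i)) ` {..<m})"
      using noetherian_ring_seq[OF K, of "\<lambda>i. k (s i)"] by auto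
    let ?S = "{1..n (s m)}" and ?F = "fgen (H (s m))"
    have "H (s m) \<subseteq> (SIGMA n:UNIV. carrier (M {1..n}))"
      using H[of "s m"] FI_submoduleD(1)[OF N] by fastforce
    note F = fgen_FI_submodule[OF this]
    have S: "finite ?S" by simp
    interpret K: noetherian_ring "ring_on (UNIV :: 'k set)" by (rule K)
    let ?I = "{k. \<exists>p\<in>?F ?S. lead ?S (x (s m)) k p}"
    have "(\<lambda>i. k (s i)) ` {..<m} \<subseteq> ?I"
    proof (rule image_subsetI)
      fix i assume "i \<in> {..<m}"
      then have im: "i < m" by simp
      from chain[OF im] obtain \<epsilon> \<kappa> where \<epsilon>: "\<epsilon> \<in> FI_hom {1..n (s i)} ?S"
        "strict_mono_on {1..n (s i)} \<epsilon>" and \<kappa>: "\<kappa> \<in> Mon ?S" and xm: "x (s m) = act \<epsilon> \<kappa> (x (s i))"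
        by blast
      have "q (s i) \<in> ?F {1..n (s i)}"
        using in_H strict_monoD[OF s im] by (intro fgen_superset)
      then have "\<phi> {1..n (s i)} ?S \<epsilon> (q (s i)) \<in> ?F ?S"
        using FI_submoduleD(6)[OF F _ S \<epsilon>(1)] by simp
      then have "single \<kappa> 1 \<odot>\<^bsub>M ?S\<^esub> \<phi> {1..n (s i)} ?S \<epsilon> (q (s i)) \<in> ?F ?S"
        using FI_submoduleD(4)[OF F S] \<kappa> by (simp add: Mon_def)
      moreover have "lead ?S (x (s m)) (k (s i)) (single \<kappa> 1 \<odot>\<^bsub>M ?S\<^esub> \<phi> {1..n (s i)} ?S \<epsilon> (q (s i)))"
        unfolding xm using lead_act[OF _ S \<epsilon> \<kappa> x lead] by simp
      ultimately show "k (s i) \<in> ?I" by blast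
    qed
    then have "genideal (ring_on UNIV) ((\<lambda>i. k (s i)) ` {..<m}) \<subseteq> ?I"
      by (rule K.genideal_minimal[OF lead_coefficient_ideal[OF F S x]])
    then obtain p where p: "p \<in> ?F ?S" "lead ?S (x (s m)) (k (s m)) p" using m by blast
    interpret abelian_group "M ?S" using module_rules(1)[OF S] .
    have pN: "p \<in> N ?S" using fgen_least[OF N, of "H (s m)" ?S] H[of "s m"] p(1) by auto
    let ?d = "q (s m) \<ominus>\<^bsub>M ?S\<^esub> p"
    have dN: "?d \<in> N ?S"
      unfolding minus_eq using FI_submoduleD(3,5)[OF N S] qN pN by blast
    have c: "q (s m) \<in> carrier (M ?S)" "p \<in> carrier (M ?S)"
      using qN pN FI_submoduleD(1)[OF N S] by blast+
    have "?d \<in> Kspan ?S (vec ?S ` lower ?S (x (s m)))" using lead_diff[OF S x lead p(2)] .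
    from lead_exists[OF S lower_subset this] have "?d \<in> ?F ?S"
    proof (elim disjE bexE exE)
      assume "?d = \<zero>\<^bsub>M ?S\<^esub>"
      then show ?thesis using FI_submoduleD(2)[OF F S] by simp
    next
      fix y k' assume "y \<in> lower ?S (x (s m))" "lead ?S y k' ?d"
      then show ?thesis using least dN by blast
    qed
    then have "?d \<oplus>\<^bsub>M ?S\<^esub> p \<in> ?F ?S" using FI_submoduleD(3)[OF F S] p(1) by blast
    moreover have "?d \<oplus>\<^bsub>M ?S\<^esub> p = q (s m)"
      unfolding minus_eq a_assoc[OF c(1) a_inv_closed[OF c(2)] c(2)] l_neg[OF c(2)]
      by (rule r_zero[OF c(1)])
    ultimately show False using q_out by simp
  qed
qed

end

theorem corollary6p18:
  fixes c :: nat
    and B :: "nat set \<Rightarrow> 'k::comm_ring_1 FI_poly set"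
    and M :: "nat set \<Rightarrow> ('k FI_poly, 'm) module"
    and \<phi> :: "nat set \<Rightarrow> nat set \<Rightarrow> (nat \<Rightarrow> nat) \<Rightarrow> 'm \<Rightarrow> 'm"
  assumes noetherian_K: "noetherian_ring (ring_on (UNIV :: 'k set))"
    and c_pos: "c \<ge> 1"
    and "FI_subalgebra c B"
    and "\<exists>G. (\<forall>(n, f) \<in> G. FI_monomial f) \<and> FI_algebra_generated_by c B G"
    and "\<And>m n \<mu> \<nu> \<epsilon> \<kappa>.
           \<lbrakk>FI_monomial \<nu>; \<nu> \<in> B {1..m}; FI_monomial \<mu>; \<mu> \<in> B {1..n};
            \<epsilon> \<in> FI_hom {1..m} {1..n}; \<kappa> \<in> FI_P c {1..n}; \<mu> = FI_star \<epsilon> \<nu> * \<kappa>\<rbrakk>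
           \<Longrightarrow> \<kappa> \<in> B {1..n}"
    and "FI_module B M \<phi>"
    and "FI_finitely_generated B M \<phi>"
  shows "FI_noetherian B M \<phi>"
proof -
  obtain G where G: "\<forall>(n, f)\<in>G. FI_monomial f" "FI_algebra_generated_by c B G"
    using assms(4) by blast
  obtain F where F: "finite F" "F \<subseteq> (SIGMA n:UNIV. carrier (M {1..n}))"
    and gen: "\<And>N. \<lbrakk>FI_submodule B M \<phi> N; \<forall>(n, q)\<in>F. q \<in> N {1..n}\<rbrakk>
                \<Longrightarrow> \<forall>S. finite S \<longrightarrow> N S = carrier (M S)"
    using assms(7) unfolding FI_finitely_generated_def by blast
  obtain gs where gs: "set gs = F" using finite_list[OF F(1)] by blast
  interpret FI_module B M \<phi> by fact
  interpret divisor_closed_FI_module B M \<phi> c gs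
  proof unfold_locales
    show "single a 1 \<in> B S" if "finite S" "p \<in> B S" "a \<in> keys p" for S p a
      using monomials_of_monomially_generated[OF assms(3) G that] .
    show "q \<in> carrier (M {1..n})" if "(n, q) \<in> set gs" for n q using that F(2) gs by auto
    show "N S = carrier (M S)"
      if "FI_submodule B M \<phi> N" "\<And>n q. (n, q) \<in> set gs \<Longrightarrow> q \<in> N {1..n}" "finite S" for N S
      using gen[OF that(1)] that(2,3) gs by auto
    fix m n \<epsilon> a \<kappa>
    assume \<epsilon>: "\<epsilon> \<in> FI_hom {1..m} {1..n}" and \<kappa>: "keys \<kappa> \<subseteq> {1..c} \<times> {1..n}"
      and B: "single a 1 \<in> B {1..m}" "single (shift \<epsilon> a + \<kappa>) 1 \<in> B {1..n}"
    show "single \<kappa> 1 \<in> B {1..n}"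
    proof (rule assms(5)[OF _ B(1) _ B(2) \<epsilon>])
      show "single \<kappa> 1 \<in> FI_P c {1..n}" using \<kappa> by (simp add: FI_P_def)
    qed (auto simp: FI_monomial_def FI_star_single mult_single)
  qed (rule assms(3))
  show ?thesis by (rule noetherian[OF noetherian_K])
qed

end
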